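(* Let $\epsilon > 0$. Then, as $x \to \infty$, all positive integers $n \leq x$ outside a set of size $o(x)$ satisfy $s(n) > 1$ and $$|\omega(s(n)) - \log\log s(n)| < \epsilon \log\log s(n).$$ Equivalently, the number of positive integers $n \le x$ for which it is not the case that both $s(n)>1$ and the displayed inequality holds is $o(x)$ as $x \to \infty$.
   Context: For a positive integer $n$, $s(n) = \sum_{d \mid n,\, d < n} d$ is the sum of the proper divisors of $n$. For a positive integer $m$, $\omega(m)$ is the number of distinct prime divisors of $m$. $\log$ is the natural logarithm. *)

theory Defs
  imports Complex_Main "HOL-Computational_Algebra.Primes" "HOL-Library.Landau_Symbols"
begin

definition aliquot_sum :: "nat \<Rightarrow> nat" where
  "aliquot_sum n = (\<Sum>d | d dvd n \<and> d < n. d)"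

definition omega :: "nat \<Rightarrow> nat" where
  "omega m = card {p. prime p \<and> p dvd m}"

end

theory Submission
  imports Defs "HOL-Computational_Algebra.Squarefree" "HOL-Number_Theory.Cong"
    "HOL-Number_Theory.Totient" "HOL-Real_Asymp.Real_Asymp"
begin

text \<open>
  Write \<open>s\<close> for the sum of proper divisors and \<open>\<sigma>\<close> for the sum of all divisors, and let \<open>x\<close> be the
  bound on \<open>n\<close>.  Outside a proportion $O(1/T)$, every $n \le x$ has a prime factor \<open>P\<close> above $x^{1/T}$ occurring exactly
  once, so $n = mP$ and
  \[ s(n) = s(m) P + \sigma(m) \]
  (\<open>aliquot_sum_mult_prime\<close>).  With \<open>m\<close> fixed, this is a linear form $uP + v$ in the prime \<open>P\<close>, and the
  task is to show that such a form usually has about $\log\log x$ prime divisors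
  $p \le y = x^{1/(\kappa \log\log x)}$; there are at most $O(\kappa \log\log x)$ prime divisors
  above \<open>y\<close>.

  The number of these \<open>p\<close> is controlled by its variance, in the manner of Turan.  The primes \<open>P\<close> are
  replaced by a majorant: Selberg's weights give a nonnegative function
  $(\sum_{e \mid n} \rho_e)^2$, with \<open>e\<close> restricted to $e \le R$, that equals \<open>1\<close> at every prime above
  \<open>R\<close> and has total mass $O(X / \log R)$ over $n \le X$.  When \<open>R\<close> is a small power of \<open>x\<close>, this
  exceeds the number of primes only by a constant factor.  Since the variance is a sum of nonnegative
  terms, it can only grow when the primes are replaced by the majorant, and for the majorant the
  distribution in residue classes modulo \<open>p\<close> and $pq$ is elementary
  (\<open>divisor_square_linear_form\<close>).  The variance turns out to be $o((\log\log x)^2)$ times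
  the total mass (\<open>divisor_square_variance\<close>), so that the constant factor does no harm, and Chebyshev's
  inequality followed by summation over \<open>m\<close> bounds the exceptional \<open>n\<close>
  (\<open>card_exceptional_on_fibres_le\<close>).

  The primes \<open>p\<close> that divide \<open>u\<close> or \<open>v\<close> need separate treatment.  Their reciprocals sum to
  $O(\log\log\log x)$ for every \<open>m\<close> (\<open>sum_prime_divisors_inverse_le\<close>), so they hardly affect the
  expected number of prime divisors.  Those dividing exactly one of \<open>u\<close>, \<open>v\<close> do not divide $uP + v$,
  except possibly \<open>P\<close> itself, and those dividing both are common divisors of \<open>m\<close> and $\sigma(m)$, which
  for almost all \<open>n\<close> lie below a fixed power of $\log x$ (\<open>prime_dvd_self_and_divisor_sum_le\<close>) and are
  therefore few.  Finally $\log\log s(n) = \log\log x + O(1)$ for these \<open>n\<close>, which turns the count into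
  the assertion.

  The facts about primes used on the way are $\sum_{p \le x} 1/p = \log\log x + O(1)$ and
  $\sum_{p \le x} \log p / p = O(\log x)$.
\<close>

section \<open>Harmonic sums and squarefree numbers\<close>

definition primes_upto :: "nat \<Rightarrow> nat set" where
  "primes_upto N = {p. prime p \<and> p \<le> N}"

lemma finite_primes_upto [simp]: "finite (primes_upto N)"
  by (rule finite_subset[of _ "{..N}"]) (auto simp: primes_upto_def)

lemma ln_Suc_le_harmonic: "ln (real N + 1) \<le> (\<Sum>n=1..N. 1 / real n)"
proof (induction N)
  case (Suc N)
  have "1 + 1 / (real N + 1) = (real (Suc N) + 1) / (real N + 1)"
    by (simp add: field_simps)
  then have "ln (real (Suc N) + 1) - ln (real N + 1) = ln (1 + 1 / (real N + 1))"
    by (simp add: ln_div)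
  also have "\<dots> \<le> 1 / (real N + 1)"
    by (rule ln_add_one_self_le_self) auto
  finally show ?case using Suc by (simp add: algebra_simps)
qed auto

lemma harmonic_le_ln: "N \<ge> 1 \<Longrightarrow> (\<Sum>n=1..N. 1 / real n) \<le> 1 + ln (real N)"
proof (induction N rule: nat_induct_at_least)
  case (Suc N)
  have "1 / (real N + 1) \<le> - ln (1 - 1 / (real N + 1))"
    using ln_le_minus_one[of "1 - 1 / (real N + 1)"] Suc by (simp add: field_simps)
  also have "1 - 1 / (real N + 1) = real N / (real N + 1)"
    by (simp add: field_simps)
  also have "- ln (real N / (real N + 1)) = ln (real N + 1) - ln (real N)"
    using Suc by (subst ln_div) auto
  finally show ?case using Suc by (simp add: algebra_simps)
qed auto

lemma sum_inverse_squares_tail: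
  assumes "a \<ge> 1" "finite S" "\<And>k. k \<in> S \<Longrightarrow> k > a"
  shows   "(\<Sum>k\<in>S. 1 / real k ^ 2) \<le> 1 / real a"
proof -
  have *: "(\<Sum>k\<in>{a<..b}. 1 / real k ^ 2) \<le> 1 / real a - 1 / real b" if "b \<ge> a" for b
    using that
  proof (induction b rule: nat_induct_at_least)
    case (Suc b)
    have b: "b \<ge> 1" using Suc assms by simp
    have "{a<..Suc b} = insert (Suc b) {a<..b}" using Suc by auto
    then have "(\<Sum>k\<in>{a<..Suc b}. 1 / real k ^ 2) \<le> 1 / real (Suc b) ^ 2 + (1 / real a - 1 / real b)"
      using Suc by simp
    also have "1 / real (Suc b) ^ 2 \<le> 1 / real b - 1 / real (Suc b)"
    proof -
      have "1 / real b - 1 / real (Suc b) = 1 / (real b * real (Suc b))"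
        using b by (simp add: field_simps)
      moreover have "1 / real (Suc b) ^ 2 \<le> 1 / (real b * real (Suc b))"
        using b unfolding power2_eq_square by (intro divide_left_mono mult_right_mono mult_pos_pos) auto
      ultimately show ?thesis by simp
    qed
    finally show ?case by simp
  qed auto
  define b where "b = max a (Max (insert 0 S))"
  have "S \<subseteq> {a<..b}"
    using assms by (auto simp: b_def le_max_iff_disj)
  then have "(\<Sum>k\<in>S. 1 / real k ^ 2) \<le> (\<Sum>k\<in>{a<..b}. 1 / real k ^ 2)"
    by (intro sum_mono2) auto
  also have "\<dots> \<le> 1 / real a - 1 / real b"
    by (rule *) (auto simp: b_def)
  also have "\<dots> \<le> 1 / real a" by simp
  finally show ?thesis .
qed

lemma sum_inverse_squares_le_2:
  assumes "finite S" "0 \<notin> S"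
  shows   "(\<Sum>k\<in>S. 1 / real k ^ 2) \<le> 2"
proof -
  have "(\<Sum>k\<in>S. 1 / real k ^ 2) \<le> (\<Sum>k\<in>insert 1 (S - {1}). 1 / real k ^ 2)"
    using assms by (intro sum_mono2) auto
  also have "\<dots> = 1 + (\<Sum>k\<in>S - {1}. 1 / real k ^ 2)"
    using assms by (simp add: sum.insert_remove)
  also have "(\<Sum>k\<in>S - {1}. 1 / real k ^ 2) \<le> 1 / real 1"
    using assms by (intro sum_inverse_squares_tail) (auto intro!: Suc_lessI intro: gr0I)
  finally show ?thesis by simp
qed

lemma squarefree_eq_prod_prime_factors:
  assumes "squarefree (n :: nat)"
  shows   "n = \<Prod>(prime_factors n)"
proof -
  have "n \<noteq> 0" using assms by (auto intro: Nat.gr0I)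
  then have "n = (\<Prod>p\<in>prime_factors n. p ^ multiplicity p n)"
    by (simp add: prod_prime_factors)
  also have "\<dots> = (\<Prod>p\<in>prime_factors n. p)"
  proof (intro prod.cong refl)
    fix p assume "p \<in> prime_factors n"
    then have "prime p" "0 < multiplicity p n" by (auto simp: prime_factors_multiplicity)
    moreover have "multiplicity p n \<le> 1"
      using assms \<open>n \<noteq> 0\<close> \<open>prime p\<close> by (auto simp: squarefree_factorial_semiring'')
    ultimately have "multiplicity p n = 1" by linarith
    then show "p ^ multiplicity p n = p" by simp
  qed
  finally show ?thesis .
qed

lemma prime_factors_prod_primes:
  assumes "finite S" "\<And>p. p \<in> S \<Longrightarrow> prime p"
  shows   "prime_factors (\<Prod>S :: nat) = S"
proof -
  have "prime_factors (\<Prod>S) = \<Union> (prime_factors ` S)"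
    using assms by (subst prime_factors_prod) (auto simp: prime_gt_0_nat dest: assms(2))
  also have "\<dots> = S"
    using assms by (auto simp: prime_prime_factors)
  finally show ?thesis .
qed

text \<open>Writing $n = l k^2$ with \<open>l\<close> squarefree shows that the squarefree numbers carry the full
  harmonic sum up to the convergent factor $\sum 1/k^2 \le 2$.\<close>
lemma sum_squarefree_inverse_ge:
  "ln (real R + 1) / 2 \<le> (\<Sum>l | squarefree l \<and> l \<in> {1..R}. 1 / real l)"
proof -
  let ?SF = "{l. squarefree l \<and> l \<in> {1..R}}"
  have fin: "finite ?SF" by (rule finite_subset[of _ "{1..R}"]) auto
  let ?f = "\<lambda>n::nat. (squarefree_part n, square_part n)"
  have inj: "inj_on ?f {1..R}"
    by (rule inj_onI) (metis Pair_inject squarefree_decompose)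
  have sub: "?f ` {1..R} \<subseteq> ?SF \<times> {1..R}"
  proof safe
    fix n assume n: "n \<in> {1..R}"
    have dec: "n = squarefree_part n * square_part n ^ 2" by (rule squarefree_decompose)
    have "square_part n \<noteq> 0" "squarefree_part n \<noteq> 0" using n by auto
    then have "squarefree_part n \<ge> 1 \<and> squarefree_part n \<le> n" "square_part n \<ge> 1 \<and> square_part n \<le> n"
      using dec n dvd_imp_le[of "squarefree_part n" n] dvd_imp_le[of "square_part n" n]
      by (metis One_nat_def Suc_leI dvd_triv_left gr0I atLeastAtMost_iff less_le_trans zero_less_one,
          metis One_nat_def Suc_leI dvd_mult dvd_power gr0I pos2 atLeastAtMost_iff less_le_trans zero_less_one
            \<open>n \<in> {1..R}\<close> \<open>square_part n dvd n \<Longrightarrow> 0 < n \<Longrightarrow> square_part n \<le> n\<close>)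
    then show "squarefree_part n \<in> {1..R}" "square_part n \<in> {1..R}" "squarefree (squarefree_part n)"
      using n by auto
  qed
  have "ln (real R + 1) \<le> (\<Sum>n=1..R. 1 / real n)" by (rule ln_Suc_le_harmonic)
  also have "\<dots> = (\<Sum>n=1..R. (\<lambda>(l,k). 1 / real l * (1 / real k ^ 2)) (?f n))"
    by (intro sum.cong refl) (metis (no_types, lifting) case_prod_conv mult.right_neutral
        of_nat_mult of_nat_power squarefree_decompose times_divide_times_eq)
  also have "\<dots> = (\<Sum>(l,k)\<in>?f ` {1..R}. 1 / real l * (1 / real k ^ 2))"
    using inj by (simp add: sum.reindex)
  also have "\<dots> \<le> (\<Sum>(l,k)\<in>?SF \<times> {1..R}. 1 / real l * (1 / real k ^ 2))"
    using fin sub by (intro sum_mono2) auto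
  also have "\<dots> = (\<Sum>l\<in>?SF. 1 / real l) * (\<Sum>k=1..R. 1 / real k ^ 2)"
    by (simp add: sum.cartesian_product sum_product)
  also have "\<dots> \<le> (\<Sum>l\<in>?SF. 1 / real l) * 2"
    by (intro mult_left_mono sum_inverse_squares_le_2 sum_nonneg) auto
  finally show ?thesis by simp
qed

section \<open>Sums over primes\<close>

text \<open>Every squarefree number up to \<open>N\<close> is a product of distinct primes up to \<open>N\<close>, so its
  reciprocal occurs when the Euler product is multiplied out.\<close>
lemma sum_inverse_primes_ge:
  assumes "N \<ge> 2"
  shows   "ln (ln (real N)) - 1 \<le> (\<Sum>p\<in>primes_upto N. 1 / real p)"
proof -
  let ?SF = "{l. squarefree l \<and> l \<in> {1..N}}"
  have inj: "inj_on prime_factors ?SF"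
    by (rule inj_onI) (metis (mono_tags, lifting) mem_Collect_eq squarefree_eq_prod_prime_factors)
  have sub: "prime_factors ` ?SF \<subseteq> Pow (primes_upto N)"
    by (auto simp: primes_upto_def prime_factors_dvd dest!: dvd_imp_le)
  have "ln (real N) / 2 \<le> ln (real N + 1) / 2" using assms by simp
  also have "\<dots> \<le> (\<Sum>l\<in>?SF. 1 / real l)" by (rule sum_squarefree_inverse_ge)
  also have "\<dots> = (\<Sum>l\<in>?SF. \<Prod>p\<in>prime_factors l. 1 / real p)"
  proof (intro sum.cong refl)
    fix l assume "l \<in> ?SF"
    then have "real l = real (\<Prod>(prime_factors l))"
      using squarefree_eq_prod_prime_factors[of l] by simp
    then show "1 / real l = (\<Prod>p\<in>prime_factors l. 1 / real p)"
      by (simp add: prod_dividef)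
  qed
  also have "\<dots> = (\<Sum>S\<in>prime_factors ` ?SF. \<Prod>p\<in>S. 1 / real p)"
    using inj by (simp add: sum.reindex)
  also have "\<dots> \<le> (\<Sum>S\<in>Pow (primes_upto N). \<Prod>p\<in>S. 1 / real p)"
    using sub by (intro sum_mono2) (auto intro!: prod_nonneg)
  also have "\<dots> = (\<Prod>p\<in>primes_upto N. 1 / real p + 1)"
    by (subst prod_add) auto
  also have "\<dots> \<le> (\<Prod>p\<in>primes_upto N. exp (1 / real p))"
    by (intro prod_mono) (auto simp: add.commute)
  also have "\<dots> = exp (\<Sum>p\<in>primes_upto N. 1 / real p)"
    by (simp add: exp_sum)
  finally have "ln (ln (real N) / 2) \<le> (\<Sum>p\<in>primes_upto N. 1 / real p)"
    using assms by (subst (asm) ln_le_cancel_iff[symmetric]) auto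
  moreover have "ln (ln (real N) / 2) = ln (ln (real N)) - ln 2"
    using assms by (subst ln_div) auto
  ultimately show ?thesis using ln_2_less_1 by linarith
qed

lemma sum_ln_prime_divisors_le:
  assumes "n > 0"
  shows   "(\<Sum>p\<in>prime_factors n. ln (real p)) \<le> ln (real n)"
proof -
  have "\<Prod>(prime_factors n) dvd (\<Prod>p\<in>prime_factors n. p ^ multiplicity p n)"
    by (intro prod_dvd_prod) (auto simp: prime_factors_multiplicity)
  then have "\<Prod>(prime_factors n) \<le> n"
    using assms by (intro dvd_imp_le) (simp_all add: prod_prime_factors)
  then have "real (\<Prod>(prime_factors n)) \<le> real n" by (rule of_nat_mono)
  moreover have "real (\<Prod>(prime_factors n)) > 0"
    using assms by (auto intro!: prod_pos simp: prime_factors_dvd prime_gt_0_nat)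
  ultimately have "ln (real (\<Prod>(prime_factors n))) \<le> ln (real n)"
    by (intro ln_mono) auto
  also have "ln (real (\<Prod>(prime_factors n))) = (\<Sum>p\<in>prime_factors n. ln (real p))"
    by (simp, subst ln_prod) (auto dest: in_prime_factors_imp_prime prime_gt_0_nat)
  finally show ?thesis .
qed

lemma card_multiples: "d > 0 \<Longrightarrow> card {n\<in>{1..N}. d dvd n} = N div d"
proof -
  assume d: "d > 0"
  have "{n\<in>{1..N}. d dvd n} = (\<lambda>k. d * k) ` {1..N div d}"
  proof safe
    fix n assume "n \<in> {1..N}" "d dvd n"
    then obtain k where k: "n = d * k" by auto
    then have "k \<in> {1..N div d}" using d \<open>n \<in> {1..N}\<close>
      by (auto simp: less_eq_div_iff_mult_less_eq mult.commute intro!: Suc_leI gr0I)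
    then show "n \<in> (*) d ` {1..N div d}" using k by auto
  next
    fix k assume k: "k \<in> {1..N div d}"
    then have "d * k \<le> N"
      using d by (auto simp: less_eq_div_iff_mult_less_eq mult.commute)
    then show "d * k \<in> {1..N}" using k d by auto
  qed auto
  then show ?thesis using d by (simp add: card_image inj_on_def)
qed

lemma card_multiples_le: "d > 0 \<Longrightarrow> real (card {n\<in>{1..N}. d dvd n}) \<le> real N / real d"
  by (subst card_multiples) (auto simp: of_nat_div_le_of_nat)

lemma sum_over_prime_divisors:
  assumes "finite Q" "\<And>p. p \<in> Q \<Longrightarrow> p > 0"
  shows "(\<Sum>n=1..N. \<Sum>p | p \<in> Q \<and> p dvd n. g p) = (\<Sum>p\<in>Q. real (N div p) * (g p :: real))"
proof -
  have "(\<Sum>n=1..N. \<Sum>p | p \<in> Q \<and> p dvd n. g p) = (\<Sum>n=1..N. \<Sum>p\<in>Q. if p dvd n then g p else 0)"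
    using assms by (simp add: sum.inter_filter)
  also have "\<dots> = (\<Sum>p\<in>Q. \<Sum>n=1..N. if p dvd n then g p else 0)"
    by (rule sum.swap)
  also have "\<dots> = (\<Sum>p\<in>Q. real (card {n\<in>{1..N}. p dvd n}) * g p)"
    by (intro sum.cong refl) (simp add: sum.inter_filter[symmetric])
  also have "\<dots> = (\<Sum>p\<in>Q. real (N div p) * g p)"
    using assms(2) by (intro sum.cong refl) (metis card_multiples)
  finally show ?thesis .
qed

text \<open>Among $1, \dots, N$ there are $\lfloor N/p \rfloor \ge N/(2p)$ multiples of a prime
  $p \le N$.  Hence half of \<open>N\<close> times the sum is at most $\ln N! \le N \ln N$.\<close>
lemma sum_ln_over_primes_le:
  assumes "N \<ge> 1"
  shows   "(\<Sum>p\<in>primes_upto N. ln (real p) / real p) \<le> 2 * ln (real N)"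
proof -
  have "real N * (\<Sum>p\<in>primes_upto N. ln (real p) / real p) = (\<Sum>p\<in>primes_upto N. real N / real p * ln (real p))"
    by (simp add: sum_distrib_left)
  also have "\<dots> \<le> (\<Sum>p\<in>primes_upto N. 2 * real (N div p) * ln (real p))"
  proof (intro sum_mono mult_right_mono)
    fix p assume p: "p \<in> primes_upto N"
    then have p': "p > 0" "p \<le> N" by (auto simp: primes_upto_def prime_gt_0_nat)
    then have "N div p \<ge> 1" by (simp add: div_greater_zero_iff Suc_le_eq)
    then have "p \<le> p * (N div p)" by simp
    moreover have "N mod p < p" using p' by simp
    ultimately have "N \<le> 2 * (p * (N div p))"
      using mult_div_mod_eq[of p N] by linarith
    then have "real N \<le> real (2 * (p * (N div p)))" by (rule of_nat_mono)
    then show "real N / real p \<le> 2 * real (N div p)"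
      using p' by (simp add: field_simps)
    show "ln (real p) \<ge> 0" using p' by simp
  qed
  also have "\<dots> = 2 * (\<Sum>n=1..N. \<Sum>p | p \<in> primes_upto N \<and> p dvd n. ln (real p))"
    by (subst sum_over_prime_divisors)
       (auto simp: sum_distrib_left primes_upto_def prime_gt_0_nat mult_ac)
  also have "(\<Sum>n=1..N. \<Sum>p | p \<in> primes_upto N \<and> p dvd n. ln (real p)) \<le> (\<Sum>n=1..N. ln (real N))"
  proof (intro sum_mono)
    fix n assume n: "n \<in> {1..N}"
    have "{p. p \<in> primes_upto N \<and> p dvd n} = prime_factors n"
      using n by (auto simp: primes_upto_def prime_factors_dvd dest: dvd_imp_le)
    then have "(\<Sum>p | p \<in> primes_upto N \<and> p dvd n. ln (real p)) \<le> ln (real n)"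
      using n sum_ln_prime_divisors_le[of n] by simp
    also have "\<dots> \<le> ln (real N)" using n by simp
    finally show "(\<Sum>p | p \<in> primes_upto N \<and> p dvd n. ln (real p)) \<le> ln (real N)" .
  qed
  finally have "real N * (\<Sum>p\<in>primes_upto N. ln (real p) / real p) \<le> real N * (2 * ln (real N))"
    by simp
  then show ?thesis using assms by (simp add: mult_le_cancel_left)
qed

text \<open>An upper bound for $\zeta(1 + \eta)$.\<close>
lemma sum_powr_le:
  assumes "\<eta> > 0" "finite S" "0 \<notin> S"
  shows   "(\<Sum>n\<in>S. real n powr (-1 - \<eta>)) \<le> 1 + 1 / \<eta>"
proof -
  have *: "(\<Sum>n=1..N. real n powr (-1 - \<eta>)) \<le> 1 + 1 / \<eta> - real N powr (-\<eta>) / \<eta>" if "N \<ge> 1" for N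
    using that
  proof (induction N rule: nat_induct_at_least)
    case (Suc N)
    have "real (Suc N) powr (-1-\<eta>) \<le> (real N powr (-\<eta>) - real (Suc N) powr (-\<eta>)) / \<eta>"
    proof -
      have "\<exists>z>real N. z < real (Suc N) \<and> real (Suc N) powr (-\<eta>) - real N powr (-\<eta>)
               = (real (Suc N) - real N) * ((-\<eta>) * z powr (-\<eta> - 1))"
        using Suc by (intro MVT2) (auto intro!: derivative_eq_intros simp: powr_diff field_simps)
      then obtain z where z: "z > real N" "z < real (Suc N)"
        "real (Suc N) powr (-\<eta>) - real N powr (-\<eta>) = (-\<eta>) * z powr (-\<eta> - 1)" by auto
      have "real (Suc N) powr (-\<eta> - 1) \<le> z powr (-\<eta> - 1)"
        using z Suc assms by (intro powr_mono2') auto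
      moreover have "(real N powr (-\<eta>) - real (Suc N) powr (-\<eta>)) / \<eta> = z powr (-\<eta> - 1)"
        using z(3) assms by (simp add: field_simps)
      moreover have "-\<eta> - 1 = -1 - \<eta>" by simp
      ultimately show ?thesis by simp
    qed
    then show ?case using Suc by (simp add: diff_divide_distrib)
  qed auto
  define N where "N = Max (insert 1 S)"
  have "S \<subseteq> {1..N}" using assms by (auto simp: N_def Suc_le_eq intro!: gr0I)
  then have "(\<Sum>n\<in>S. real n powr (-1 - \<eta>)) \<le> (\<Sum>n=1..N. real n powr (-1 - \<eta>))"
    by (intro sum_mono2) auto
  also have "\<dots> \<le> 1 + 1 / \<eta> - real N powr (-\<eta>) / \<eta>"
    using assms by (intro *) (auto simp: N_def)
  also have "\<dots> \<le> 1 + 1 / \<eta>" using assms by simp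
  finally show ?thesis .
qed

text \<open>Rankin's device: with exponent $1 + \eta$ the Euler product over the primes is at most
  $\zeta(1+\eta) \le 1 + 1/\eta$, and since $p^{-\eta} \ge 1 - \eta \ln p$, passing from
  $p^{-1-\eta}$ to $p^{-1}$ costs only $\eta \sum \ln p / p$.  This is $O(1)$ for
  $\eta = 1/\ln N$.\<close>
lemma sum_inverse_primes_le:
  assumes "N \<ge> 3"
  shows   "(\<Sum>p\<in>primes_upto N. 1 / real p) \<le> ln (ln (real N)) + 5"
proof -
  \<comment> \<open>balances $\ln(1 + 1/\eta)$ against $\eta \sum \ln p / p$\<close>
  define \<eta> where "\<eta> = 1 / ln (real N)"
  let ?P = "primes_upto N"
  have lnN: "ln (real N) \<ge> 1"
  proof -
    have "exp 1 \<le> real N" using exp_le assms by linarith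
    then show ?thesis using assms by (subst ln_ge_iff) auto
  qed
  have \<eta>: "\<eta> > 0" using lnN by (simp add: \<eta>_def)
  have P: "p \<in> ?P \<Longrightarrow> prime p \<and> p \<ge> 2" for p by (auto simp: primes_upto_def prime_ge_2_nat)
  have inj: "inj_on (\<lambda>S. \<Prod>S) (Pow ?P)"
    by (rule inj_onI)
       (metis PowD P finite_primes_upto finite_subset in_mono prime_factors_prod_primes)
  have "(\<Prod>p\<in>?P. real p powr (-1-\<eta>) + 1) = (\<Sum>S\<in>Pow ?P. \<Prod>p\<in>S. real p powr (-1-\<eta>))"
    by (subst prod_add) auto
  also have "\<dots> = (\<Sum>S\<in>Pow ?P. real (\<Prod>S) powr (-1-\<eta>))"
    by (intro sum.cong refl) (simp add: prod_powr_distrib)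
  also have "\<dots> = (\<Sum>n\<in>(\<lambda>S. \<Prod>S) ` Pow ?P. real n powr (-1-\<eta>))"
    using inj by (simp add: sum.reindex)
  also have "\<dots> \<le> 1 + 1 / \<eta>"
  proof (intro sum_powr_le \<eta>)
    show "0 \<notin> Prod ` Pow ?P"
    proof
      assume "0 \<in> Prod ` Pow ?P"
      then obtain S where S: "S \<subseteq> ?P" "0 = \<Prod>S" by auto
      then show False using P by (metis finite_primes_upto finite_subset not_prime_0 prod_zero_iff subsetD)
    qed
  qed auto
  also have "1 + 1 / \<eta> = 1 + ln (real N)" by (simp add: \<eta>_def)
  finally have prod_le: "(\<Prod>p\<in>?P. real p powr (-1-\<eta>) + 1) \<le> 1 + ln (real N)" .
  have "(\<Sum>p\<in>?P. 1 / real p) \<le> (\<Sum>p\<in>?P. ln (real p powr (-1-\<eta>) + 1) + 1 / real p ^ 2 + \<eta> * (ln (real p) / real p))"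
  proof (rule sum_mono)
    fix p assume "p \<in> ?P"
    then have p: "p \<ge> 2" using P by auto
    let ?v = "real p powr (-1-\<eta>)"
    have v: "?v = 1 / real p * real p powr (-\<eta>)"
      using p by (simp add: powr_diff powr_minus field_simps)
    have "1 - \<eta> * ln (real p) \<le> real p powr (-\<eta>)"
      using p exp_ge_add_one_self[of "- \<eta> * ln (real p)"] by (simp add: powr_def)
    then have "1 / real p * (1 - \<eta> * ln (real p)) \<le> ?v"
      unfolding v by (intro mult_left_mono) auto
    then have 1: "1 / real p \<le> ?v + \<eta> * (ln (real p) / real p)"
      using p by (simp add: field_simps)
    have "real p powr (-\<eta>) \<le> 1" using p \<eta> by (simp add: powr_minus ge_one_powr_ge_zero field_simps)
    then have "?v \<le> 1 / real p" unfolding v using p by (simp add: field_simps)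
    moreover have "?v \<ge> 0" by simp
    ultimately have "?v ^ 2 \<le> (1 / real p) ^ 2" by (intro power_mono) auto
    moreover have "1 / real p \<le> 1" using p by simp
    then have "?v \<le> 1" using \<open>?v \<le> 1 / real p\<close> by linarith
    then have "ln (1 + ?v) \<ge> ?v - ?v ^ 2" by (intro ln_one_plus_pos_lower_bound) auto
    ultimately show "1 / real p \<le> ln (?v + 1) + 1 / real p ^ 2 + \<eta> * (ln (real p) / real p)"
      using 1 by (simp add: power_divide add.commute)
  qed
  also have "\<dots> = ln (\<Prod>p\<in>?P. real p powr (-1-\<eta>) + 1) + (\<Sum>p\<in>?P. 1 / real p ^ 2)
                + \<eta> * (\<Sum>p\<in>?P. ln (real p) / real p)"
  proof -
    have "real p powr (-1-\<eta>) + 1 > 0" for p by (intro add_nonneg_pos) auto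
    then have "ln (\<Prod>p\<in>?P. real p powr (-1-\<eta>) + 1) = (\<Sum>p\<in>?P. ln (real p powr (-1-\<eta>) + 1))"
      by (intro ln_prod) (auto simp: less_imp_neq[symmetric])
    then show ?thesis
      by (simp only: sum.distrib sum_distrib_left)
  qed
  also have "ln (\<Prod>p\<in>?P. real p powr (-1-\<eta>) + 1) \<le> ln (1 + ln (real N))"
    using prod_le by (intro ln_mono prod_pos) (auto intro!: add_nonneg_pos)
  also have "ln (1 + ln (real N)) \<le> ln (2 * ln (real N))"
    using lnN by (intro ln_mono) auto
  also have "ln (2 * ln (real N)) = ln 2 + ln (ln (real N))"
    using lnN by (subst ln_mult) auto
  also have "(\<Sum>p\<in>?P. 1 / real p ^ 2) \<le> 2"
    by (intro sum_inverse_squares_le_2) (auto simp: primes_upto_def)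
  also have "\<eta> * (\<Sum>p\<in>?P. ln (real p) / real p) \<le> \<eta> * (2 * ln (real N))"
    using assms \<eta> by (intro mult_left_mono sum_ln_over_primes_le) auto
  also have "\<dots> = 2" using lnN by (simp add: \<eta>_def)
  finally show ?thesis using ln_2_less_1 by simp
qed

lemma sum_inverse_primes_minus_one_le:
  assumes "N \<ge> 3"
  shows   "(\<Sum>p\<in>primes_upto N. 1 / (real p - 1)) \<le> ln (ln (real N)) + 9"
proof -
  have "(\<Sum>p\<in>primes_upto N. 1 / (real p - 1)) \<le> (\<Sum>p\<in>primes_upto N. 1 / real p + 2 * (1 / real p ^ 2))"
  proof (rule sum_mono)
    fix p assume "p \<in> primes_upto N"
    then have "real p \<ge> 2" by (auto simp: primes_upto_def dest: prime_ge_2_nat)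
    then show "1 / (real p - 1) \<le> 1 / real p + 2 * (1 / real p ^ 2)"
      by (simp add: divide_simps power2_eq_square) (simp add: algebra_simps)
  qed
  also have "\<dots> \<le> (ln (ln (real N)) + 5) + 2 * 2"
    unfolding sum.distrib sum_distrib_left[symmetric]
    using assms by (intro add_mono sum_inverse_primes_le mult_left_mono sum_inverse_squares_le_2)
      (auto simp: primes_upto_def)
  finally show ?thesis by simp
qed

lemma card_prime_factors_le:
  assumes "(n :: nat) > 0" "n \<le> 2 ^ K"
  shows   "card (prime_factors n) \<le> K"
proof -
  have "2 ^ card (prime_factors n) = (\<Prod>p\<in>prime_factors n. 2 :: nat)" by simp
  also have "\<dots> \<le> (\<Prod>p\<in>prime_factors n. p ^ multiplicity p n)"
  proof (intro prod_mono conjI)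
    fix p assume p: "p \<in> prime_factors n"
    then have "2 ^ 1 \<le> p ^ 1" by (auto dest: in_prime_factors_imp_prime prime_ge_2_nat)
    also have "p ^ 1 \<le> p ^ multiplicity p n"
      using p by (intro power_increasing) (auto simp: prime_factors_multiplicity prime_gt_0_nat Suc_le_eq)
    finally show "2 \<le> p ^ multiplicity p n" by simp
  qed auto
  also have "\<dots> = n" using assms by (simp add: prod_prime_factors)
  finally have "(2::nat) ^ card (prime_factors n) \<le> 2 ^ K" using assms by linarith
  then show ?thesis by simp
qed

text \<open>There are at most \<open>K\<close> prime factors.  Those above \<open>K\<close> contribute $O(1)$ and the others at most
  $\sum_{p \le K} 1/(p-1)$.  For a number of size $x^{O(1)}$ the total is $O(\log\log\log x)$.\<close>
lemma sum_prime_divisors_inverse_le: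
  assumes "(n :: nat) > 0" "n \<le> 2 ^ K" "K \<ge> 3"
  shows   "(\<Sum>p\<in>prime_factors n. 1 / (real p - 1)) \<le> ln (ln (real K)) + 10"
proof -
  let ?A = "{p\<in>prime_factors n. p \<le> K}" and ?B = "{p\<in>prime_factors n. p > K}"
  have "prime_factors n = ?A \<union> ?B" by auto
  then have "(\<Sum>p\<in>prime_factors n. 1 / (real p - 1)) = (\<Sum>p\<in>?A. 1 / (real p - 1)) + (\<Sum>p\<in>?B. 1 / (real p - 1))"
    by (subst sum.union_disjoint[symmetric]) auto
  also have "(\<Sum>p\<in>?A. 1 / (real p - 1)) \<le> (\<Sum>p\<in>primes_upto K. 1 / (real p - 1))"
    by (intro sum_mono2) (auto simp: primes_upto_def prime_factors_dvd dest: prime_gt_0_nat)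
  also have "\<dots> \<le> ln (ln (real K)) + 9"
    by (intro sum_inverse_primes_minus_one_le assms)
  also have "(\<Sum>p\<in>?B. 1 / (real p - 1)) \<le> real (card ?B) * (1 / real K)"
    using assms by (intro sum_bounded_above) (auto intro!: divide_left_mono)
  also have "\<dots> \<le> real K * (1 / real K)"
  proof (intro mult_right_mono)
    have "card ?B \<le> card (prime_factors n)" by (intro card_mono) auto
    also have "\<dots> \<le> K" by (intro card_prime_factors_le assms)
    finally show "real (card ?B) \<le> real K" by simp
  qed auto
  also have "\<dots> = 1" using assms by simp
  finally show ?thesis by simp
qed

section \<open>Selberg weights\<close>

text \<open>On squarefree numbers, where its values matter, this is the Moebius function.\<close>
definition omega_sign :: "nat \<Rightarrow> real" where
  "omega_sign n = (-1) ^ card (prime_factors n)"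

lemma abs_omega_sign [simp]: "\<bar>omega_sign n\<bar> = 1"
  by (simp add: omega_sign_def power_abs)

lemma omega_sign_squared [simp]: "omega_sign n * omega_sign n = 1"
  by (simp add: omega_sign_def flip: power_mult_distrib)

lemma omega_sign_mult_prime:
  assumes "prime p" "\<not> p dvd e" "e > 0"
  shows   "omega_sign (p * e) = - omega_sign e"
proof -
  have "prime_factors (p * e) = insert p (prime_factors e)"
    using assms by (subst prime_factors_product) (auto simp: prime_prime_factors)
  moreover have "p \<notin> prime_factors e" using assms by auto
  ultimately show ?thesis by (simp add: omega_sign_def)
qed

text \<open>Moebius inversion on an interval of the divisibility order: for a prime \<open>p\<close> dividing $k/l$,
  the map toggling the factor \<open>p\<close> pairs terms of opposite sign.\<close>
lemma sum_omega_sign_between: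
  assumes k: "squarefree k" and l: "l dvd k"
  shows   "(\<Sum>e | l dvd e \<and> e dvd k. omega_sign e) = (if l = k then omega_sign k else 0)"
proof (cases "l = k")
  case True
  then have "{e. l dvd e \<and> e dvd k} = {k}" by (auto intro: dvd_antisym)
  then show ?thesis using True by simp
next
  case False
  let ?A = "{e. l dvd e \<and> e dvd k}"
  have k0: "k > 0" using k by (auto intro!: gr0I)
  obtain q where q: "k = l * q" using l by auto
  have "q \<noteq> 1" using q False by auto
  then obtain p where p: "prime p" "p dvd q" using prime_factor_nat by blast
  have nsq: "\<not> p * p dvd k"
    using k p squarefreeD[of k p] by (auto simp: power2_eq_square)
  have pl: "\<not> p dvd l" using nsq p q by (auto intro: mult_dvd_mono)
  define g where "g e = (if p dvd e then e div p else p * e)" for e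
  have pk: "p dvd k" using p q by simp
  have g: "g e \<in> ?A \<and> g (g e) = e \<and> omega_sign (g e) = - omega_sign e" if e: "e \<in> ?A" for e
  proof (cases "p dvd e")
    case True
    then obtain e' where e': "e = p * e'" by auto
    have p0: "p > 0" using p prime_gt_0_nat by simp
    have "e > 0" using e k0 by (auto intro!: gr0I)
    then have e'0: "e' > 0" using e' by (auto intro!: gr0I)
    have ne': "\<not> p dvd e'" using nsq e e' by (metis (no_types, lifting) dvd_trans mem_Collect_eq mult_dvd_mono dvd_refl)
    have ge: "g e = e'" using True e' p0 by (simp add: g_def)
    have "coprime l p" using pl p by (metis coprime_commute prime_imp_coprime)
    then have "l dvd e'" using e e' by (simp add: coprime_dvd_mult_right_iff)
    moreover have "e' dvd k" using e e' by auto
    ultimately show ?thesis using ge ne' e' omega_sign_mult_prime[OF p(1) ne' e'0] by (simp add: g_def)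
  next
    case False
    have e0: "e > 0" using e k0 by (auto intro!: gr0I)
    have p0: "p > 0" using p prime_gt_0_nat by simp
    have "coprime p e" using False p by (simp add: prime_imp_coprime)
    then have "p * e dvd k" using e pk by (auto intro: divides_mult)
    then show ?thesis using False e p0 omega_sign_mult_prime[OF p(1) False e0] by (simp add: g_def)
  qed
  have "(\<Sum>e\<in>?A. omega_sign e) = (\<Sum>e\<in>?A. - omega_sign e)"
    by (rule sum.reindex_bij_witness[where i = g and j = g]) (use g in auto)
  then show ?thesis using False by (simp add: sum_negf)
qed

definition squarefree_upto :: "nat \<Rightarrow> nat set" where
  "squarefree_upto R = {l. squarefree l \<and> l \<in> {1..R}}"

lemma finite_squarefree_upto [simp]: "finite (squarefree_upto R)"
  by (rule finite_subset[of _ "{1..R}"]) (auto simp: squarefree_upto_def)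

text \<open>Selberg's problem is to minimise $\sum_{e_1, e_2 \le R} \rho_{e_1} \rho_{e_2} / [e_1, e_2]$ subject to
  $\rho_1 = 1$.  In the variables $y_l = \sum_{l \mid e} \rho_e / e$ the form is diagonal, with
  coefficients $\varphi(l)$, and the minimum is attained at $y_l$ proportional to
  $\mu(l)/\varphi(l)$.  Below $y_l$ is taken proportional to $\mu(l)/l$ instead, which still gives
  $O(1/\ln R)$ and makes the normalising sum elementary.\<close>
definition selberg_H :: "nat \<Rightarrow> real" where
  "selberg_H R = (\<Sum>l\<in>squarefree_upto R. 1 / real l)"

definition selberg_weight :: "nat \<Rightarrow> nat \<Rightarrow> real" where
  "selberg_weight R e = real e * omega_sign e * (\<Sum>l | l \<in> squarefree_upto R \<and> e dvd l. 1 / real l) / selberg_H R"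

lemma selberg_H_ge: "selberg_H R \<ge> ln (real R + 1) / 2"
  using sum_squarefree_inverse_ge[of R] by (simp add: selberg_H_def squarefree_upto_def)

lemma selberg_H_pos: "R \<ge> 1 \<Longrightarrow> selberg_H R > 0"
  by (rule less_le_trans[OF _ selberg_H_ge]) auto

lemma selberg_weight_1:
  assumes "R \<ge> 1"
  shows   "selberg_weight R 1 = 1"
proof -
  have "{l. l \<in> squarefree_upto R \<and> 1 dvd l} = squarefree_upto R" by auto
  then show ?thesis using selberg_H_pos[OF assms]
    by (simp add: selberg_weight_def selberg_H_def omega_sign_def)
qed

lemma abs_selberg_weight_le:
  assumes "R \<ge> 1"
  shows   "\<bar>selberg_weight R e\<bar> \<le> real e"
proof -
  have "(\<Sum>l | l \<in> squarefree_upto R \<and> e dvd l. 1 / real l) \<le> selberg_H R"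
    unfolding selberg_H_def by (intro sum_mono2) auto
  moreover have "(\<Sum>l | l \<in> squarefree_upto R \<and> e dvd l. 1 / real l) \<ge> 0" by (intro sum_nonneg) auto
  ultimately show ?thesis using selberg_H_pos[OF assms]
    by (simp add: selberg_weight_def abs_mult field_simps) (metis mult.commute mult_right_mono of_nat_0_le_iff)
qed

text \<open>The weights were defined by Moebius inversion from these values of $y_l$.\<close>
lemma selberg_diagonal:
  assumes "R \<ge> 1" "l \<in> {1..R}"
  shows   "(\<Sum>e | e \<in> {1..R} \<and> l dvd e. selberg_weight R e / real e) =
             (if squarefree l then omega_sign l / (real l * selberg_H R) else 0)"
proof -
  let ?E = "{e. e \<in> {1..R} \<and> l dvd e}"
  have "(\<Sum>e\<in>?E. selberg_weight R e / real e)
      = (\<Sum>e\<in>?E. \<Sum>k\<in>squarefree_upto R. if e dvd k then omega_sign e * (1 / real k) / selberg_H R else 0)"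
  proof (intro sum.cong refl)
    fix e assume "e \<in> ?E"
    then have "selberg_weight R e / real e = omega_sign e * (\<Sum>k | k \<in> squarefree_upto R \<and> e dvd k. 1 / real k) / selberg_H R"
      by (auto simp: selberg_weight_def)
    also have "\<dots> = (\<Sum>k | k \<in> squarefree_upto R \<and> e dvd k. omega_sign e * (1 / real k) / selberg_H R)"
      by (simp add: sum_distrib_left sum_divide_distrib)
    also have "\<dots> = (\<Sum>k\<in>squarefree_upto R. if e dvd k then omega_sign e * (1 / real k) / selberg_H R else 0)"
      by (rule sum.inter_filter) simp
    finally show "selberg_weight R e / real e = (\<Sum>k\<in>squarefree_upto R. if e dvd k then omega_sign e * (1 / real k) / selberg_H R else 0)" .
  qed
  also have "\<dots> = (\<Sum>k\<in>squarefree_upto R. \<Sum>e\<in>?E. if e dvd k then omega_sign e * (1 / real k) / selberg_H R else 0)"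
    by (rule sum.swap)
  also have "\<dots> = (\<Sum>k\<in>squarefree_upto R. if k = l then omega_sign l / (real l * selberg_H R) else 0)"
  proof (intro sum.cong refl)
    fix k assume k: "k \<in> squarefree_upto R"
    then have k': "squarefree k" "k \<ge> 1" "k \<le> R" by (auto simp: squarefree_upto_def)
    have "(\<Sum>e\<in>?E. if e dvd k then omega_sign e * (1 / real k) / selberg_H R else 0)
        = (\<Sum>e | e \<in> ?E \<and> e dvd k. omega_sign e * (1 / real k) / selberg_H R)"
      by (subst sum.inter_filter) auto
    also have "{e. e \<in> ?E \<and> e dvd k} = {e. l dvd e \<and> e dvd k}"
      using k' by (auto dest: dvd_imp_le intro!: Suc_leI gr0I)
    also have "(\<Sum>e | l dvd e \<and> e dvd k. omega_sign e * (1 / real k) / selberg_H R)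
             = (\<Sum>e | l dvd e \<and> e dvd k. omega_sign e) * (1 / real k) / selberg_H R"
      by (simp add: sum_distrib_right sum_divide_distrib)
    also have "(\<Sum>e | l dvd e \<and> e dvd k. omega_sign e) = (if k = l then omega_sign l else 0)"
    proof (cases "l dvd k")
      case True
      then show ?thesis using k' by (simp add: sum_omega_sign_between eq_commute)
    next
      case False
      then have "{e. l dvd e \<and> e dvd k} = {}" by (auto dest: dvd_trans)
      then have "(\<Sum>e | l dvd e \<and> e dvd k. omega_sign e) = 0" by (simp only: sum.empty)
      then show ?thesis using False by auto
    qed
    finally show "(\<Sum>e\<in>?E. if e dvd k then omega_sign e * (1 / real k) / selberg_H R else 0)
        = (if k = l then omega_sign l / (real l * selberg_H R) else 0)" by auto
  qed
  also have "\<dots> = (if l \<in> squarefree_upto R then omega_sign l / (real l * selberg_H R) else 0)"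
    by simp
  finally show ?thesis using assms by (simp add: squarefree_upto_def)
qed

lemma gcd_eq_sum_totient:
  assumes "a \<in> {1..R}"
  shows   "real (gcd a b) = (\<Sum>l=1..R. if l dvd a \<and> l dvd b then real (totient l) else 0)"
proof -
  have "real (gcd a b) = (\<Sum>l | l dvd gcd a b. real (totient l))"
    by (subst totient_divisor_sum[symmetric]) simp
  also have "{l. l dvd gcd a b} = {l \<in> {1..R}. l dvd a \<and> l dvd b}"
    using assms by (auto dest: dvd_imp_le intro!: Suc_leI gr0I)
  finally show ?thesis by (simp only: sum.inter_filter finite_atLeastAtMost)
qed

text \<open>Expanding $1/[e_1,e_2] = (e_1,e_2)/(e_1 e_2)$ and $(e_1,e_2) = \sum_{l \mid (e_1,e_2)} \varphi(l)$
  turns the form into $\sum_l \varphi(l) y_l^2$.  With the chosen $y_l$ and $\varphi(l) \le l$ this is at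
  most the reciprocal of the normalising sum.\<close>
lemma selberg_quadratic_form_le:
  assumes R: "R \<ge> 1"
  shows   "(\<Sum>e1=1..R. \<Sum>e2=1..R. selberg_weight R e1 * selberg_weight R e2 / real (lcm e1 e2))
             \<le> 2 / ln (real R + 1)"
proof -
  let ?w = "\<lambda>e. selberg_weight R e / real e"
  have "(\<Sum>e1=1..R. \<Sum>e2=1..R. selberg_weight R e1 * selberg_weight R e2 / real (lcm e1 e2))
      = (\<Sum>e1=1..R. \<Sum>e2=1..R. \<Sum>l=1..R. real (totient l) *
           ((if l dvd e1 then ?w e1 else 0) * (if l dvd e2 then ?w e2 else 0)))"
  proof (intro sum.cong refl)
    fix e1 e2 assume e: "e1 \<in> {1..R}" "e2 \<in> {1..R}"
    have "real (lcm e1 e2) * real (gcd e1 e2) = real e1 * real e2"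
      by (metis lcm_mult_gcd mult.commute of_nat_mult prod_gcd_lcm_nat)
    moreover have "real (gcd e1 e2) > 0" "real (lcm e1 e2) > 0" using e by (auto simp: lcm_pos_nat)
    ultimately have "1 / real (lcm e1 e2) = real (gcd e1 e2) / (real e1 * real e2)"
      using e by (simp add: field_simps)
    then have "selberg_weight R e1 * selberg_weight R e2 * (1 / real (lcm e1 e2))
             = selberg_weight R e1 * selberg_weight R e2 * (real (gcd e1 e2) / (real e1 * real e2))"
      by (simp only:)
    then have "selberg_weight R e1 * selberg_weight R e2 / real (lcm e1 e2)
             = ?w e1 * ?w e2 * real (gcd e1 e2)"
      by simp
    also have "\<dots> = (\<Sum>l=1..R. ?w e1 * ?w e2 * (if l dvd e1 \<and> l dvd e2 then real (totient l) else 0))"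
      by (subst gcd_eq_sum_totient[OF e(1)]) (simp only: sum_distrib_left)
    also have "\<dots> = (\<Sum>l=1..R. real (totient l) *
           ((if l dvd e1 then ?w e1 else 0) * (if l dvd e2 then ?w e2 else 0)))"
      by (intro sum.cong refl) auto
    finally show "selberg_weight R e1 * selberg_weight R e2 / real (lcm e1 e2) = \<dots>" .
  qed
  also have "\<dots> = (\<Sum>l=1..R. real (totient l) * (\<Sum>e=1..R. if l dvd e then ?w e else 0)^2)"
  proof -
    have "(\<Sum>e1=1..R. \<Sum>e2=1..R. \<Sum>l=1..R. h e1 e2 l) = (\<Sum>l=1..R. \<Sum>e1=1..R. \<Sum>e2=1..R. h e1 e2 l)"
      for h :: "nat \<Rightarrow> nat \<Rightarrow> nat \<Rightarrow> real"
      by (subst sum.swap, subst (2) sum.swap, subst (3) sum.swap) (rule sum.swap)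
    then show ?thesis
      by (simp only: power2_eq_square sum_product) (simp only: sum_distrib_left)
  qed
  also have "\<dots> = (\<Sum>l=1..R. real (totient l) * (if squarefree l then omega_sign l / (real l * selberg_H R) else 0)^2)"
  proof (intro sum.cong refl)
    fix l assume l: "l \<in> {1..R}"
    have "(\<Sum>e=1..R. if l dvd e then ?w e else 0) = (\<Sum>e | e \<in> {1..R} \<and> l dvd e. ?w e)"
      by (subst sum.inter_filter) auto
    then show "real (totient l) * (\<Sum>e=1..R. if l dvd e then ?w e else 0)^2
        = real (totient l) * (if squarefree l then omega_sign l / (real l * selberg_H R) else 0)^2"
      using selberg_diagonal[OF R l] by simp
  qed
  also have "\<dots> \<le> (\<Sum>l=1..R. if squarefree l then 1 / real l / selberg_H R ^ 2 else 0)"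
  proof (intro sum_mono)
    fix l assume l: "l \<in> {1..R}"
    have "real (totient l) * (omega_sign l / (real l * selberg_H R))^2 = real (totient l) / real l / real l / selberg_H R ^ 2"
      by (simp add: power2_eq_square mult_ac)
    also have "\<dots> \<le> 1 / real l / selberg_H R ^ 2"
      using l totient_le[of l] by (intro divide_right_mono) auto
    finally show "real (totient l) * (if squarefree l then omega_sign l / (real l * selberg_H R) else 0)^2
        \<le> (if squarefree l then 1 / real l / selberg_H R ^ 2 else 0)" by simp
  qed
  also have "\<dots> = (\<Sum>l\<in>squarefree_upto R. 1 / real l / selberg_H R ^ 2)"
  proof -
    have "squarefree_upto R = {l\<in>{1..R}. squarefree l}" by (auto simp: squarefree_upto_def)
    then show ?thesis by (simp only: sum.inter_filter finite_atLeastAtMost)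
  qed
  also have "\<dots> = selberg_H R / selberg_H R ^ 2"
    by (simp add: selberg_H_def sum_divide_distrib)
  also have "\<dots> = 1 / selberg_H R" using selberg_H_pos[OF R] by (simp add: power2_eq_square)
  also have "\<dots> \<le> 1 / (ln (real R + 1) / 2)"
    using R selberg_H_pos[OF R] by (intro divide_left_mono selberg_H_ge mult_pos_pos) auto
  finally show ?thesis by simp
qed

section \<open>Weights in residue classes\<close>

lemma card_residue_class:
  assumes k: "k > 0"
  shows   "\<bar>real (card {n\<in>{1..X}. [n = c] (mod k)}) - real X / real k\<bar> \<le> 1"
proof -
  \<comment> \<open>the representative in $[1, k]$, because the count starts at \<open>1\<close>\<close>
  define r where "r = (if c mod k = 0 then k else c mod k)"
  have r: "1 \<le> r" "r \<le> k" "[r = c] (mod k)"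
    using k by (auto simp: r_def unique_euclidean_semiring_class.cong_def intro!: Suc_leI less_imp_le)
  let ?J = "{..<(X + k - r) div k}"
  have J: "j \<in> ?J \<longleftrightarrow> r + k * j \<le> X" for j
  proof -
    have "j \<in> ?J \<longleftrightarrow> Suc j \<le> (X + k - r) div k" by auto
    also have "\<dots> \<longleftrightarrow> Suc j * k \<le> X + k - r" using k by (simp add: less_eq_div_iff_mult_less_eq)
    also have "\<dots> \<longleftrightarrow> r + k * j \<le> X" using r by (simp add: algebra_simps) linarith
    finally show ?thesis .
  qed
  have "{n\<in>{1..X}. [n = c] (mod k)} = (\<lambda>j. r + k * j) ` ?J"
  proof (intro equalityI subsetI)
    fix n assume n: "n \<in> {n\<in>{1..X}. [n = c] (mod k)}"
    then have nr: "n mod k = r mod k" using r(3) by (auto simp: unique_euclidean_semiring_class.cong_def)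
    have "r \<le> n"
    proof (cases "c mod k = 0")
      case True
      then have "k dvd n" using n by (auto simp: unique_euclidean_semiring_class.cong_def)
      then show ?thesis using n True by (auto simp: r_def dest: dvd_imp_le)
    next
      case False
      then have "n mod k = r" using n by (auto simp: unique_euclidean_semiring_class.cong_def r_def)
      then show ?thesis by (metis mod_less_eq_dividend)
    qed
    then have "k dvd n - r" using nr by (metis mod_eq_dvd_iff_nat)
    then obtain j where "n - r = k * j" by auto
    then have j: "n = r + k * j" using \<open>r \<le> n\<close> by simp
    then have "j \<in> ?J" using n J by auto
    then show "n \<in> (\<lambda>j. r + k * j) ` ?J" using j by blast
  next
    fix n assume "n \<in> (\<lambda>j. r + k * j) ` ?J"
    then obtain j where "j \<in> ?J" "n = r + k * j" by auto
    then show "n \<in> {n\<in>{1..X}. [n = c] (mod k)}"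
      using J r by (auto simp: unique_euclidean_semiring_class.cong_def)
  qed
  then have "card {n\<in>{1..X}. [n = c] (mod k)} = (X + k - r) div k"
    using k by (simp add: card_image inj_on_def)
  moreover have "real ((X + k - r) div k) \<le> real (X + k - r) / real k" by (rule of_nat_div_le_of_nat)
  moreover have "real (X + k - r) / real k < real ((X + k - r) div k) + 1"
  proof -
    have "X + k - r < k * ((X + k - r) div k + 1)"
      using k by (metis add.commute dividend_less_times_div mult.commute mult_Suc_right plus_1_eq_Suc)
    then have "real (X + k - r) < real (k * ((X + k - r) div k + 1))" by (rule of_nat_less_iff[THEN iffD2])
    then show ?thesis using k by (simp add: field_simps)
  qed
  moreover have "real (X + k - r) / real k = real X / real k + 1 - real r / real k"
    using r k by (simp add: of_nat_diff field_simps)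
  moreover have "0 < real r / real k" "real r / real k \<le> 1" using r k by auto
  ultimately show ?thesis by linarith
qed

text \<open>For coprime moduli the two conditions combine to one residue class modulo $dm$.  Otherwise they
  are incompatible, because \<open>a\<close> is coprime to \<open>d\<close>.\<close>
lemma card_residue_class_multiples:
  assumes d: "d > 0" and a: "coprime a d" and m: "m > 0"
  shows   "\<bar>real (card {n\<in>{1..X}. [n = a] (mod d) \<and> m dvd n})
             - (if coprime m d then real X / (real d * real m) else 0)\<bar> \<le> 1"
proof (cases "coprime m d")
  case True
  then have "coprime d m" by (simp add: coprime_commute)
  then obtain c where c: "[c = a] (mod d)" "[c = 0] (mod m)"
    using binary_chinese_remainder_nat by blast
  have "{n\<in>{1..X}. [n = a] (mod d) \<and> m dvd n} = {n\<in>{1..X}. [n = c] (mod (d * m))}"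
  proof (intro Collect_cong conj_cong refl)
    fix n
    have "[n = c] (mod (d * m)) \<longleftrightarrow> [n = c] (mod d) \<and> [n = c] (mod m)"
      using \<open>coprime d m\<close> by (metis coprime_cong_mult_nat cong_modulus_mult_nat mult.commute)
    also have "[n = c] (mod d) \<longleftrightarrow> [n = a] (mod d)" using c by (meson cong_sym cong_trans)
    also have "[n = c] (mod m) \<longleftrightarrow> [n = 0] (mod m)" using c by (meson cong_sym cong_trans)
    also have "\<dots> \<longleftrightarrow> m dvd n" by (rule cong_0_iff)
    finally show "([n = a] (mod d) \<and> m dvd n) = [n = c] (mod (d * m))" by simp
  qed
  then show ?thesis using True card_residue_class[of "d * m" X c] d m by simp
next
  case False
  have "{n\<in>{1..X}. [n = a] (mod d) \<and> m dvd n} = {}"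
  proof (rule ccontr)
    assume "{n\<in>{1..X}. [n = a] (mod d) \<and> m dvd n} \<noteq> {}"
    then obtain n where n: "[n = a] (mod d)" "m dvd n" by auto
    have "coprime n d" using n(1) a by (metis cong_imp_coprime cong_sym)
    then have "coprime m d" using n(2) by (meson coprime_divisors dvd_refl)
    then show False using False by simp
  qed
  then have "card {n\<in>{1..X}. [n = a] (mod d) \<and> m dvd n} = 0" by (simp only: card.empty)
  then show ?thesis using False by (simp only: if_False)
qed

definition divisor_square :: "(nat \<Rightarrow> real) \<Rightarrow> nat \<Rightarrow> nat \<Rightarrow> real" where
  "divisor_square \<rho> R n = (\<Sum>e=1..R. if e dvd n then \<rho> e else 0) ^ 2"

lemma divisor_square_nonneg [simp]: "divisor_square \<rho> R n \<ge> 0"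
  by (simp add: divisor_square_def)

text \<open>The expected value of a sum of \<open>divisor_square\<close> over $n \le X$ in a residue class coprime to \<open>d\<close>;
  it is the same for all such classes.\<close>
definition local_main_term :: "(nat \<Rightarrow> real) \<Rightarrow> nat \<Rightarrow> nat \<Rightarrow> nat \<Rightarrow> real" where
  "local_main_term \<rho> R X d = (\<Sum>e1=1..R. \<Sum>e2=1..R. \<rho> e1 * \<rho> e2 *
     (if coprime (lcm e1 e2) d then real X / (real d * real (lcm e1 e2)) else 0))"

lemma divisor_square_progression:
  assumes d: "d > 0" and a: "coprime a d"
  shows   "\<bar>(\<Sum>n | n \<in> {1..X} \<and> [n = a] (mod d). divisor_square \<rho> R n) - local_main_term \<rho> R X d\<bar>
             \<le> (\<Sum>e=1..R. \<bar>\<rho> e\<bar>) ^ 2"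
proof -
  let ?A = "{n. n \<in> {1..X} \<and> [n = a] (mod d)}"
  let ?c = "\<lambda>e1 e2. real (card {n\<in>{1..X}. [n = a] (mod d) \<and> lcm e1 e2 dvd n})"
  let ?m = "\<lambda>e1 e2. (if coprime (lcm e1 e2) d then real X / (real d * real (lcm e1 e2)) else 0)"
  have "(\<Sum>n\<in>?A. divisor_square \<rho> R n)
      = (\<Sum>n\<in>?A. \<Sum>e1=1..R. \<Sum>e2=1..R. if lcm e1 e2 dvd n then \<rho> e1 * \<rho> e2 else 0)"
    unfolding divisor_square_def power2_eq_square sum_product
    by (intro sum.cong refl) auto
  also have "\<dots> = (\<Sum>e1=1..R. \<Sum>e2=1..R. \<Sum>n\<in>?A. if lcm e1 e2 dvd n then \<rho> e1 * \<rho> e2 else 0)"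
    by (subst sum.swap, rule sum.cong, rule refl, rule sum.swap)
  also have "\<dots> = (\<Sum>e1=1..R. \<Sum>e2=1..R. \<rho> e1 * \<rho> e2 * ?c e1 e2)"
  proof (intro sum.cong refl)
    fix e1 e2
    have "(\<Sum>n\<in>?A. if lcm e1 e2 dvd n then \<rho> e1 * \<rho> e2 else 0)
        = (\<Sum>n | n \<in> ?A \<and> lcm e1 e2 dvd n. \<rho> e1 * \<rho> e2)"
      by (subst sum.inter_filter) auto
    also have "{n. n \<in> ?A \<and> lcm e1 e2 dvd n} = {n\<in>{1..X}. [n = a] (mod d) \<and> lcm e1 e2 dvd n}"
      by auto
    finally show "(\<Sum>n\<in>?A. if lcm e1 e2 dvd n then \<rho> e1 * \<rho> e2 else 0) = \<rho> e1 * \<rho> e2 * ?c e1 e2"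
      by simp
  qed
  finally have eq: "(\<Sum>n\<in>?A. divisor_square \<rho> R n) - local_main_term \<rho> R X d
      = (\<Sum>e1=1..R. \<Sum>e2=1..R. \<rho> e1 * \<rho> e2 * (?c e1 e2 - ?m e1 e2))"
    by (simp only: local_main_term_def sum_subtractf[symmetric] right_diff_distrib)
  have "\<bar>\<Sum>e1=1..R. \<Sum>e2=1..R. \<rho> e1 * \<rho> e2 * (?c e1 e2 - ?m e1 e2)\<bar>
      \<le> (\<Sum>e1=1..R. \<Sum>e2=1..R. \<bar>\<rho> e1\<bar> * \<bar>\<rho> e2\<bar>)"
  proof (intro order_trans[OF sum_abs] sum_mono)
    fix e1 e2 assume "e1 \<in> {1..R}" "e2 \<in> {1..R}"
    then have "lcm e1 e2 > 0" by (auto simp: lcm_pos_nat)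
    then have "\<bar>?c e1 e2 - ?m e1 e2\<bar> \<le> 1" by (intro card_residue_class_multiples d a)
    then have "\<bar>\<rho> e1\<bar> * \<bar>\<rho> e2\<bar> * \<bar>?c e1 e2 - ?m e1 e2\<bar> \<le> \<bar>\<rho> e1\<bar> * \<bar>\<rho> e2\<bar> * 1"
      by (intro mult_left_mono) auto
    then show "\<bar>\<rho> e1 * \<rho> e2 * (?c e1 e2 - ?m e1 e2)\<bar> \<le> \<bar>\<rho> e1\<bar> * \<bar>\<rho> e2\<bar>"
      by (simp add: abs_mult)
  qed
  also have "\<dots> = (\<Sum>e=1..R. \<bar>\<rho> e\<bar>) ^ 2" by (simp add: power2_eq_square sum_product)
  finally show ?thesis unfolding eq .
qed

lemma linear_form_residue_class:
  fixes d u v :: nat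
  assumes d: "d > 1" and u: "coprime u d" and v: "coprime v d"
  shows   "\<exists>a. coprime a d \<and> (\<forall>n. d dvd u * n + v \<longleftrightarrow> [n = a] (mod d))"
proof -
  obtain w where w: "[u * w = 1] (mod d)"
    using u cong_solve_coprime_nat[of u d] by auto
  \<comment> \<open>the solution $-v/u$, with $d - 1$ in place of $-1$ to stay in the natural numbers\<close>
  define a where "a = w * (v * (d - 1))"
  have cw: "coprime w d" using w by (metis cong_imp_coprime cong_sym coprime_1_left coprime_mult_left_iff)
  have cd: "coprime (d - 1) d" using d by (metis coprime_commute coprime_diff_one_right_nat less_imp_le_nat gr_implies_not0 neq0_conv coprime_diff_one_left_nat)
  have ca: "coprime a d" unfolding a_def using cw v cd by simp
  have "[u * a = 1 * (v * (d - 1))] (mod d)"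
    unfolding a_def mult.assoc[symmetric, of u w] using w by (rule cong_scalar_right)
  then have "[u * a + v = v * (d - 1) + v] (mod d)" by (simp add: cong_add_rcancel_nat)
  also have "v * (d - 1) + v = v * d" using d by (cases d) auto
  also have "[v * d = 0] (mod d)" by (simp add: cong_0_iff)
  finally have ua: "[u * a + v = 0] (mod d)" .
  have "d dvd u * n + v \<longleftrightarrow> [n = a] (mod d)" for n
  proof -
    have "d dvd u * n + v \<longleftrightarrow> [u * n + v = 0] (mod d)" by (simp add: cong_0_iff)
    also have "\<dots> \<longleftrightarrow> [u * n + v = u * a + v] (mod d)" using ua by (meson cong_sym cong_trans)
    also have "\<dots> \<longleftrightarrow> [u * n = u * a] (mod d)" by (rule cong_add_rcancel_nat)
    also have "\<dots> \<longleftrightarrow> [n = a] (mod d)" using u by (simp add: cong_mult_lcancel_nat)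
    finally show ?thesis .
  qed
  then show ?thesis using ca by blast
qed

text \<open>Every residue class coprime to \<open>d\<close> carries the same mass up to a bounded error.  The mass of one
  class can therefore be replaced by the average over all of them.\<close>
lemma divisor_square_linear_form:
  fixes d u v :: nat
  assumes d: "d > 1" and u: "coprime u d" and v: "coprime v d"
  shows "\<bar>(\<Sum>n | n \<in> {1..X} \<and> d dvd u * n + v. divisor_square \<rho> R n)
           - (\<Sum>n | n \<in> {1..X} \<and> coprime n d. divisor_square \<rho> R n) / real (totient d)\<bar>
          \<le> 2 * (\<Sum>e=1..R. \<bar>\<rho> e\<bar>) ^ 2"
proof -
  let ?K = "(\<Sum>e=1..R. \<bar>\<rho> e\<bar>) ^ 2" and ?A = "local_main_term \<rho> R X d"
  let ?S = "\<lambda>a. \<Sum>n | n \<in> {1..X} \<and> [n = a] (mod d). divisor_square \<rho> R n"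
  let ?T = "\<Sum>n | n \<in> {1..X} \<and> coprime n d. divisor_square \<rho> R n"
  obtain a where a: "coprime a d" "\<And>n. d dvd u * n + v \<longleftrightarrow> [n = a] (mod d)"
    using linear_form_residue_class[OF assms] by blast
  have 1: "\<bar>?S b - ?A\<bar> \<le> ?K" if "coprime b d" for b
    using d that by (intro divisor_square_progression) auto
  have "?T = (\<Sum>b\<in>totatives d. \<Sum>n | n \<in> {n. n \<in> {1..X} \<and> coprime n d} \<and> n mod d = b. divisor_square \<rho> R n)"
  proof (rule sum.group[symmetric])
    show "(\<lambda>n. n mod d) ` {n. n \<in> {1..X} \<and> coprime n d} \<subseteq> totatives d"
    proof safe
      fix n assume "coprime n d"
      then have "coprime (n mod d) d" using d by (simp add: coprime_mod_left_iff)
      moreover have "n mod d \<noteq> 0" using \<open>coprime (n mod d) d\<close> d by (metis coprime_0_left_iff less_irrefl nat_dvd_1_iff_1)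
      ultimately show "n mod d \<in> totatives d" using d by (auto simp: in_totatives_iff intro: less_imp_le)
    qed
  qed auto
  also have "\<dots> = (\<Sum>b\<in>totatives d. ?S b)"
  proof (intro sum.cong refl)
    fix b assume b: "b \<in> totatives d"
    then have b': "coprime b d" "b < d" using d by (auto simp: in_totatives_iff totatives_less)
    have "n mod d = b \<longleftrightarrow> [n = b] (mod d)" for n
      using b' by (simp add: unique_euclidean_semiring_class.cong_def)
    moreover have "coprime n d" if "[n = b] (mod d)" for n
      using that b' by (metis cong_imp_coprime cong_sym)
    ultimately show "{n \<in> {n. n \<in> {1..X} \<and> coprime n d}. n mod d = b} = {n. n \<in> {1..X} \<and> [n = b] (mod d)}"
      by auto
  qed
  finally have T: "?T = (\<Sum>b\<in>totatives d. ?S b)" .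
  have \<phi>: "real (totient d) > 0" using d by simp
  have "\<bar>?T - real (totient d) * ?A\<bar> = \<bar>\<Sum>b\<in>totatives d. ?S b - ?A\<bar>"
    unfolding T sum_subtractf totient_def by simp
  also have "\<dots> \<le> (\<Sum>b\<in>totatives d. ?K)"
    by (intro order_trans[OF sum_abs] sum_mono 1) (auto simp: in_totatives_iff)
  also have "\<dots> = real (totient d) * ?K" by (simp add: totient_def)
  finally have "\<bar>?T - real (totient d) * ?A\<bar> / real (totient d) \<le> ?K"
    using \<phi> by (simp add: field_simps)
  also have "\<bar>?T - real (totient d) * ?A\<bar> / real (totient d) = \<bar>?T / real (totient d) - ?A\<bar>"
    using \<phi> by (simp add: abs_div_pos diff_divide_distrib)
  finally have "\<bar>?T / real (totient d) - ?A\<bar> \<le> ?K" .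
  moreover have "\<bar>?S a - ?A\<bar> \<le> ?K" by (rule 1) fact
  moreover have "(\<Sum>n | n \<in> {1..X} \<and> d dvd u * n + v. divisor_square \<rho> R n) = ?S a"
    using a by simp
  ultimately show ?thesis by linarith
qed

section \<open>Prime divisors of a linear form along the primes\<close>

text \<open>Opening the square reduces the variance to the masses of single residue classes modulo \<open>p\<close> and
  modulo $pq$.  Bounding the average over coprime classes from above by the total mass \<open>S\<close> is harmless
  in the second moment.  In the first moment a lower bound is required, and there the mass of the
  multiples of \<open>p\<close> is lost.  Summed over \<open>p\<close> with the factor $1/(p-1)$ this loss is at most $GS$.  The
  terms $M^2 S$ cancel, and what is left is linear in \<open>M\<close>, apart from \<open>G\<close>.\<close>
lemma divisor_square_variance:
  fixes \<rho> :: "nat \<Rightarrow> real" and R X u v :: nat and Q :: "nat set"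
  defines "w \<equiv> divisor_square \<rho> R"
  defines "K \<equiv> (\<Sum>e=1..R. \<bar>\<rho> e\<bar>) ^ 2"
  defines "M \<equiv> (\<Sum>p\<in>Q. 1 / (real p - 1))"
  defines "S \<equiv> (\<Sum>n=1..X. w n)"
  defines "f \<equiv> (\<lambda>n. real (card {p\<in>Q. p dvd u * n + v}))"
  assumes Q: "finite Q" "\<And>p. p \<in> Q \<Longrightarrow> prime p" "\<And>p. p \<in> Q \<Longrightarrow> \<not> p dvd u" "\<And>p. p \<in> Q \<Longrightarrow> \<not> p dvd v"
    and G: "\<And>n. n \<in> {1..X} \<Longrightarrow> (\<Sum>p | p \<in> Q \<and> p dvd n. 1 / (real p - 1)) \<le> G"
  shows "(\<Sum>n=1..X. w n * (f n - M) ^ 2) \<le> S * (M + 2 * M * G) + 6 * K * real (card Q) ^ 2"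
proof -
  let ?q = "real (card Q)"
  have p2: "real p - 1 \<ge> 1" if "p \<in> Q" for p using prime_ge_2_nat[OF Q(2)[OF that]] by simp
  have wn: "w n \<ge> 0" for n by (simp add: w_def)
  have K0: "K \<ge> 0" by (simp add: K_def)
  have S0: "S \<ge> 0" unfolding S_def by (intro sum_nonneg wn)
  have M0: "M \<ge> 0" unfolding M_def using p2 by (intro sum_nonneg) (force)
  have Mq: "M \<le> ?q"
  proof -
    have "M \<le> (\<Sum>p\<in>Q. 1)" unfolding M_def
    proof (intro sum_mono)
      fix p assume "p \<in> Q"
      then show "1 / (real p - 1) \<le> 1" using p2[of p] by simp
    qed
    then show ?thesis by simp
  qed
  have copr: "coprime u p \<and> coprime v p" if "p \<in> Q" for p
    using that Q by (metis coprime_commute prime_imp_coprime)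
  let ?L = "\<lambda>d. \<Sum>n | n \<in> {1..X} \<and> d dvd u * n + v. w n"
  let ?T = "\<lambda>d. \<Sum>n | n \<in> {1..X} \<and> coprime n d. w n"
  have L: "\<bar>?L d - ?T d / real (totient d)\<bar> \<le> 2 * K" if "d > 1" "coprime u d" "coprime v d" for d
    using divisor_square_linear_form[OF that, where X = X and \<rho> = \<rho> and R = R] by (simp add: w_def K_def)
  have TS: "?T d \<le> S" for d unfolding S_def by (intro sum_mono2 wn) auto
  have Lp: "\<bar>?L p - ?T p / (real p - 1)\<bar> \<le> 2 * K" if "p \<in> Q" for p
  proof -
    have "prime p" using that Q by blast
    then have "real (totient p) = real p - 1" by (simp add: totient_prime of_nat_diff prime_ge_Suc_0_nat)
    then show ?thesis using L[of p] copr[OF that] prime_gt_1_nat[OF \<open>prime p\<close>] by simp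
  qed

  have T_p: "?T p = S - (\<Sum>n=1..X. if p dvd n then w n else 0)" if "p \<in> Q" for p
  proof -
    have "coprime n p \<longleftrightarrow> \<not> p dvd n" for n
      using Q(2)[OF that] by (metis coprime_commute prime_imp_coprime coprime_absorb_left not_prime_unit)
    then have "?T p = (\<Sum>n\<in>{n\<in>{1..X}. \<not> p dvd n}. w n)" by (intro sum.cong) auto
    also have "\<dots> = (\<Sum>n=1..X. if \<not> p dvd n then w n else 0)" by (rule sum.inter_filter) simp
    also have "\<dots> = (\<Sum>n=1..X. w n - (if p dvd n then w n else 0))" by (intro sum.cong refl) auto
    finally show ?thesis by (simp add: S_def sum_subtractf)
  qed
  have f_sum: "f n = (\<Sum>p\<in>Q. if p dvd u * n + v then 1 else 0)" for n
    unfolding f_def using Q(1) by (simp add: sum.inter_filter[symmetric])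
  have "(\<Sum>n=1..X. w n * f n) = (\<Sum>n=1..X. \<Sum>p\<in>Q. if p dvd u * n + v then w n else 0)"
    unfolding f_sum sum_distrib_left by (intro sum.cong refl) auto
  also have "\<dots> = (\<Sum>p\<in>Q. \<Sum>n=1..X. if p dvd u * n + v then w n else 0)" by (rule sum.swap)
  also have "\<dots> = (\<Sum>p\<in>Q. ?L p)"
  proof (rule sum.cong[OF refl])
    fix p
    have "(\<Sum>n=1..X. if p dvd u * n + v then w n else 0) = (\<Sum>n\<in>{n\<in>{1..X}. p dvd u * n + v}. w n)"
      by (rule sum.inter_filter[symmetric]) simp
    then show "(\<Sum>n=1..X. if p dvd u * n + v then w n else 0) = ?L p" by simp
  qed
  finally have m1: "(\<Sum>n=1..X. w n * f n) = (\<Sum>p\<in>Q. ?L p)" .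
  have "M * S - G * S - 2 * K * ?q \<le> (\<Sum>p\<in>Q. ?L p)"
  proof -
    \<comment> \<open>the mass lost to the multiples of the primes, bounded by the hypothesis on \<open>G\<close> at each \<open>n\<close>\<close>
    have "(\<Sum>p\<in>Q. \<Sum>n=1..X. if p dvd n then w n * (1 / (real p - 1)) else 0)
        = (\<Sum>n=1..X. \<Sum>p\<in>Q. if p dvd n then w n * (1 / (real p - 1)) else 0)" by (rule sum.swap)
    also have "\<dots> \<le> (\<Sum>n=1..X. w n * G)"
    proof (intro sum_mono)
      fix n assume n: "n \<in> {1..X}"
      have "(\<Sum>p\<in>Q. if p dvd n then w n * (1 / (real p - 1)) else 0)
          = (\<Sum>p\<in>{p\<in>Q. p dvd n}. w n * (1 / (real p - 1)))"
        using Q(1) by (rule sum.inter_filter[symmetric])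
      also have "\<dots> = w n * (\<Sum>p\<in>{p\<in>Q. p dvd n}. 1 / (real p - 1))" by (simp only: sum_distrib_left)
      also have "\<dots> \<le> w n * G" using G[OF n] by (intro mult_left_mono wn) simp
      finally show "(\<Sum>p\<in>Q. if p dvd n then w n * (1 / (real p - 1)) else 0) \<le> w n * G" .
    qed
    also have "\<dots> = G * S" by (simp add: S_def sum_distrib_left mult.commute)
    finally have bad: "(\<Sum>p\<in>Q. \<Sum>n=1..X. if p dvd n then w n * (1 / (real p - 1)) else 0) \<le> G * S" .
    have "M * S - (\<Sum>p\<in>Q. \<Sum>n=1..X. if p dvd n then w n * (1 / (real p - 1)) else 0) - 2 * K * ?q
        = (\<Sum>p\<in>Q. 1 / (real p - 1) * S - (\<Sum>n=1..X. if p dvd n then w n * (1 / (real p - 1)) else 0) - 2 * K)"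
      by (simp add: sum_subtractf M_def sum_distrib_right)
    also have "\<dots> \<le> (\<Sum>p\<in>Q. ?L p)"
    proof (intro sum_mono)
      fix p assume p: "p \<in> Q"
      have "(\<Sum>n=1..X. if p dvd n then w n * (1 / (real p - 1)) else 0)
          = (\<Sum>n=1..X. if p dvd n then w n else 0) / (real p - 1)"
        unfolding sum_divide_distrib by (intro sum.cong refl) auto
      then have "1 / (real p - 1) * S - (\<Sum>n=1..X. if p dvd n then w n * (1 / (real p - 1)) else 0) = ?T p / (real p - 1)"
        unfolding T_p[OF p] by (simp add: diff_divide_distrib)
      then show "1 / (real p - 1) * S - (\<Sum>n=1..X. if p dvd n then w n * (1 / (real p - 1)) else 0) - 2 * K \<le> ?L p"
        using Lp[OF p] by linarith
    qed
    finally show ?thesis using bad by linarith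
  qed
  then have first: "M * S - G * S - 2 * K * ?q \<le> (\<Sum>n=1..X. w n * f n)" unfolding m1 .

  have f2: "f n ^ 2 = (\<Sum>p\<in>Q. \<Sum>q\<in>Q. if p dvd u * n + v \<and> q dvd u * n + v then 1 else 0)" for n
    unfolding f_sum power2_eq_square sum_product by (intro sum.cong refl) auto
  have "(\<Sum>n=1..X. w n * f n ^ 2)
      = (\<Sum>n=1..X. \<Sum>p\<in>Q. \<Sum>q\<in>Q. if p dvd u * n + v \<and> q dvd u * n + v then w n else 0)"
    unfolding f2 sum_distrib_left by (intro sum.cong refl) auto
  also have "\<dots> = (\<Sum>p\<in>Q. \<Sum>q\<in>Q. \<Sum>n=1..X. if p dvd u * n + v \<and> q dvd u * n + v then w n else 0)"
    by (subst sum.swap, rule sum.cong, rule refl, rule sum.swap)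
  also have "\<dots> \<le> (\<Sum>p\<in>Q. \<Sum>q\<in>Q. S * (1 / (real p - 1) * (1 / (real q - 1))) + 2 * K + (if p = q then S / (real p - 1) else 0))"
  proof (intro sum_mono)
    fix p q assume pq: "p \<in> Q" "q \<in> Q"
    show "(\<Sum>n=1..X. if p dvd u * n + v \<and> q dvd u * n + v then w n else 0)
       \<le> S * (1 / (real p - 1) * (1 / (real q - 1))) + 2 * K + (if p = q then S / (real p - 1) else 0)"
    proof (cases "p = q")
      case True
      have "(\<Sum>n=1..X. if p dvd u * n + v then w n else 0) = (\<Sum>n\<in>{n\<in>{1..X}. p dvd u * n + v}. w n)"
        by (rule sum.inter_filter[symmetric]) simp
      then have "(\<Sum>n=1..X. if p dvd u * n + v \<and> q dvd u * n + v then w n else 0) = ?L p"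
        using True by simp
      also have "\<dots> \<le> ?T p / (real p - 1) + 2 * K" using Lp[OF pq(1)] by linarith
      also have "?T p / (real p - 1) \<le> S / (real p - 1)"
        using p2[OF pq(1)] by (intro divide_right_mono TS) auto
      finally have "(\<Sum>n=1..X. if p dvd u * n + v \<and> q dvd u * n + v then w n else 0) \<le> S / (real p - 1) + 2 * K"
        by simp
      moreover have "S * (1 / (real p - 1) * (1 / (real q - 1))) \<ge> 0"
        using S0 p2[OF pq(1)] p2[OF pq(2)] by (intro mult_nonneg_nonneg divide_nonneg_nonneg) auto
      ultimately show ?thesis using True by simp
    next
      case False
      have pr: "prime p" "prime q" using pq Q by auto
      then have c: "coprime p q" using False by (simp add: primes_coprime)
      have "(p dvd x \<and> q dvd x) = (p * q dvd x)" for x using c by (auto intro: divides_mult dvd_mult_left dvd_mult_right)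
      then have "(\<Sum>n=1..X. if p dvd u * n + v \<and> q dvd u * n + v then w n else 0)
          = (\<Sum>n=1..X. if p * q dvd u * n + v then w n else 0)" by simp
      moreover have "(\<Sum>n=1..X. if p * q dvd u * n + v then w n else 0)
          = (\<Sum>n\<in>{n\<in>{1..X}. p * q dvd u * n + v}. w n)"
        by (rule sum.inter_filter[symmetric]) simp
      moreover have "?L (p * q) \<le> ?T (p * q) / real (totient (p * q)) + 2 * K"
      proof -
        have "p * q > 1" using pr by (metis less_1_mult prime_gt_1_nat)
        then show ?thesis using L[of "p * q"] copr[OF pq(1)] copr[OF pq(2)] by simp
      qed
      ultimately have le: "(\<Sum>n=1..X. if p dvd u * n + v \<and> q dvd u * n + v then w n else 0)
          \<le> ?T (p * q) / real (totient (p * q)) + 2 * K" by simp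
      have tot: "real (totient (p * q)) = (real p - 1) * (real q - 1)"
        using pr c by (simp add: totient_mult_coprime totient_prime of_nat_diff prime_ge_Suc_0_nat)
      have "?T (p * q) / ((real p - 1) * (real q - 1)) \<le> S / ((real p - 1) * (real q - 1))"
        using p2[OF pq(1)] p2[OF pq(2)] by (intro divide_right_mono TS) auto
      then show ?thesis using False le unfolding tot by simp
    qed
  qed
  also have "\<dots> = S * M ^ 2 + 2 * K * ?q ^ 2 + S * M"
  proof -
    have "(\<Sum>p\<in>Q. \<Sum>q\<in>Q. S * (1 / (real p - 1) * (1 / (real q - 1)))) = S * M ^ 2"
    proof -
      have "M ^ 2 = (\<Sum>p\<in>Q. \<Sum>q\<in>Q. 1 / (real p - 1) * (1 / (real q - 1)))"
        unfolding M_def power2_eq_square sum_product ..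
      then show ?thesis by (simp only: sum_distrib_left)
    qed
    moreover have "(\<Sum>p\<in>Q. \<Sum>q\<in>Q. 2 * K) = 2 * K * ?q ^ 2" by (simp add: power2_eq_square)
    moreover have "(\<Sum>p\<in>Q. \<Sum>q\<in>Q. if p = q then S / (real p - 1) else 0) = S * M"
      using Q(1) by (simp add: M_def sum_distrib_left)
    ultimately show ?thesis by (simp only: sum.distrib)
  qed
  finally have second: "(\<Sum>n=1..X. w n * f n ^ 2) \<le> S * M ^ 2 + 2 * K * ?q ^ 2 + S * M" .
  have "(\<Sum>n=1..X. w n * (f n - M) ^ 2)
      = (\<Sum>n=1..X. w n * f n ^ 2 - 2 * M * (w n * f n) + M ^ 2 * w n)"
    by (intro sum.cong refl) (simp add: power2_eq_square algebra_simps)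
  also have "\<dots> = (\<Sum>n=1..X. w n * f n ^ 2) - 2 * M * (\<Sum>n=1..X. w n * f n) + M ^ 2 * S"
    by (simp only: sum.distrib sum_subtractf sum_distrib_left[symmetric] S_def)
  also have "\<dots> \<le> (S * M ^ 2 + 2 * K * ?q ^ 2 + S * M) - 2 * M * (M * S - G * S - 2 * K * ?q) + M ^ 2 * S"
    using second mult_left_mono[OF first, of "2 * M"] M0 by linarith
  also have "\<dots> = S * (M + 2 * M * G) + 2 * K * ?q ^ 2 + 4 * K * ?q * M"
    by (simp add: power2_eq_square algebra_simps)
  also have "4 * K * ?q * M \<le> 4 * K * ?q * ?q" using Mq K0 by (intro mult_left_mono) auto
  finally show ?thesis by (simp add: power2_eq_square)
qed

lemma selberg_weight_abs_sum_le:
  assumes "R \<ge> 1"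
  shows "(\<Sum>e=1..R. \<bar>selberg_weight R e\<bar>) ^ 2 \<le> real R ^ 4"
proof -
  have "(\<Sum>e=1..R. \<bar>selberg_weight R e\<bar>) \<le> (\<Sum>e=1..R. real R)"
    by (intro sum_mono order_trans[OF abs_selberg_weight_le[OF assms]]) auto
  also have "\<dots> = real R ^ 2" by (simp add: power2_eq_square)
  finally have "(\<Sum>e=1..R. \<bar>selberg_weight R e\<bar>) ^ 2 \<le> (real R ^ 2) ^ 2"
    by (intro power_mono sum_nonneg) auto
  then show ?thesis by simp
qed

lemma selberg_total_mass_le:
  assumes "R \<ge> 1"
  shows "(\<Sum>n=1..X. divisor_square (selberg_weight R) R n) \<le> 2 * real X / ln (real R + 1) + real R ^ 4"
proof -
  let ?\<rho> = "selberg_weight R"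
  have "{n. n \<in> {1..X} \<and> [n = 1] (mod 1)} = {1..X}" by auto
  then have "(\<Sum>n=1..X. divisor_square ?\<rho> R n) \<le> local_main_term ?\<rho> R X 1 + (\<Sum>e=1..R. \<bar>?\<rho> e\<bar>) ^ 2"
    using divisor_square_progression[of 1 1, where X = X and \<rho> = ?\<rho> and R = R] by simp
  also have "local_main_term ?\<rho> R X 1
      = real X * (\<Sum>e1=1..R. \<Sum>e2=1..R. ?\<rho> e1 * ?\<rho> e2 / real (lcm e1 e2))"
    unfolding local_main_term_def sum_distrib_left by (intro sum.cong refl) auto
  also have "\<dots> \<le> real X * (2 / ln (real R + 1))"
    by (intro mult_left_mono selberg_quadratic_form_le assms) auto
  finally show ?thesis using selberg_weight_abs_sum_le[OF assms] by (simp add: mult.commute)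
qed

lemma divisor_square_selberg_prime:
  assumes "R \<ge> 1" "prime P" "P > R"
  shows "divisor_square (selberg_weight R) R P = 1"
proof -
  have "(\<Sum>e=1..R. if e dvd P then selberg_weight R e else 0) = (\<Sum>e=1..R. if e = 1 then 1 else 0)"
    using assms by (intro sum.cong refl) (auto simp: prime_nat_iff selberg_weight_1[simplified])
  then show ?thesis using assms by (simp add: divisor_square_def)
qed

lemma card_primes_le:
  assumes "R \<ge> 1"
  shows "real (card {P\<in>{1..X}. prime P \<and> P > R}) \<le> 2 * real X / ln (real R + 1) + real R ^ 4"
proof -
  let ?A = "{P\<in>{1..X}. prime P \<and> P > R}"
  have "real (card ?A) = (\<Sum>P\<in>?A. divisor_square (selberg_weight R) R P)"
    using assms by (simp add: divisor_square_selberg_prime)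
  also have "\<dots> \<le> (\<Sum>n=1..X. divisor_square (selberg_weight R) R n)" by (intro sum_mono2) auto
  also have "\<dots> \<le> 2 * real X / ln (real R + 1) + real R ^ 4" by (rule selberg_total_mass_le[OF assms])
  finally show ?thesis .
qed

text \<open>Chebyshev's inequality.  The variance is a sum of nonnegative terms, so the sum over the primes
  above \<open>R\<close>, where the majorant equals \<open>1\<close>, is at most the sum over all $n \le X$.\<close>
lemma card_primes_exceptional_le:
  fixes R X u v :: nat and Q :: "nat set" and c G :: real
  defines "M \<equiv> (\<Sum>p\<in>Q. 1 / (real p - 1))"
  assumes Q: "finite Q" "\<And>p. p \<in> Q \<Longrightarrow> prime p" "\<And>p. p \<in> Q \<Longrightarrow> \<not> p dvd u" "\<And>p. p \<in> Q \<Longrightarrow> \<not> p dvd v"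
    and G: "G \<ge> 0" "\<And>n. n \<in> {1..X} \<Longrightarrow> (\<Sum>p | p \<in> Q \<and> p dvd n. 1 / (real p - 1)) \<le> G"
    and R: "R \<ge> 1" and c: "c \<ge> 0"
  shows "real (card {P\<in>{1..X}. prime P \<and> P > R \<and> c \<le> \<bar>real (card {p\<in>Q. p dvd u * P + v}) - M\<bar>}) * c ^ 2
     \<le> (2 * real X / ln (real R + 1) + real R ^ 4) * (M + 2 * M * G) + 6 * real R ^ 4 * real (card Q) ^ 2"
proof -
  let ?w = "divisor_square (selberg_weight R) R"
  let ?f = "\<lambda>n. real (card {p\<in>Q. p dvd u * n + v})"
  let ?A = "{P\<in>{1..X}. prime P \<and> P > R \<and> c \<le> \<bar>?f P - M\<bar>}"
  have M0: "M \<ge> 0" unfolding M_def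
    using prime_ge_Suc_0_nat[OF Q(2)] by (intro sum_nonneg) auto
  have "real (card ?A) * c ^ 2 = (\<Sum>P\<in>?A. c ^ 2)" by simp
  also have "\<dots> \<le> (\<Sum>P\<in>?A. ?w P * (?f P - M) ^ 2)"
  proof (intro sum_mono)
    fix P assume P: "P \<in> ?A"
    have "c ^ 2 \<le> \<bar>?f P - M\<bar> ^ 2" using P c by (intro power_mono) auto
    then show "c ^ 2 \<le> ?w P * (?f P - M) ^ 2"
      using P R by (simp add: divisor_square_selberg_prime)
  qed
  also have "\<dots> \<le> (\<Sum>n=1..X. ?w n * (?f n - M) ^ 2)" by (intro sum_mono2) auto
  also have "\<dots> \<le> (\<Sum>n=1..X. ?w n) * (M + 2 * M * G) + 6 * (\<Sum>e=1..R. \<bar>selberg_weight R e\<bar>) ^ 2 * real (card Q) ^ 2"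
    unfolding M_def using Q G(2) by (rule divisor_square_variance)
  also have "\<dots> \<le> (2 * real X / ln (real R + 1) + real R ^ 4) * (M + 2 * M * G) + 6 * real R ^ 4 * real (card Q) ^ 2"
    using M0 G(1) R
    by (intro add_mono mult_right_mono mult_left_mono selberg_total_mass_le selberg_weight_abs_sum_le) auto
  finally show ?thesis .
qed

section \<open>Sums of divisors of $mP$\<close>

definition divisor_sum :: "nat \<Rightarrow> nat" where
  "divisor_sum m = (\<Sum>d | d dvd m. d)"

lemma aliquot_sum_plus_self:
  assumes "m > 0"
  shows   "aliquot_sum m + m = divisor_sum m"
proof -
  have "{d. d dvd m} = insert m {d. d dvd m \<and> d < m}"
    using assms by (auto dest: dvd_imp_le)
  moreover have "finite {d. d dvd m \<and> d < m}" by (rule finite_subset[of _ "{..<m}"]) auto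
  ultimately show ?thesis by (simp add: divisor_sum_def aliquot_sum_def)
qed

lemma divisor_sum_mult_coprime:
  assumes "coprime a b"
  shows   "divisor_sum (a * b) = divisor_sum a * divisor_sum b"
proof -
  let ?D = "{d. d dvd a} \<times> {d. d dvd b}"
  have inj: "inj_on (\<lambda>(x,y). x * y) ?D"
  proof (rule inj_onI, clarsimp)
    fix x y x' y' assume *: "x dvd a" "y dvd b" "x' dvd a" "y' dvd b" "x * y = x' * y'"
    have c: "coprime x y'" "coprime x' y" "coprime x y" "coprime x' y'"
      using * assms by (meson coprime_divisors)+
    have "x dvd x'" using * c by (metis coprime_dvd_mult_left_iff dvd_triv_left)
    moreover have "x' dvd x" using * c by (metis coprime_dvd_mult_left_iff dvd_triv_left)
    moreover have "y dvd y'" using * c by (metis coprime_commute coprime_dvd_mult_right_iff dvd_triv_right)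
    moreover have "y' dvd y" using * c by (metis coprime_commute coprime_dvd_mult_right_iff dvd_triv_right)
    ultimately show "x = x' \<and> y = y'" by (auto intro: dvd_antisym)
  qed
  have img: "(\<lambda>(x,y). x * y) ` ?D = {d. d dvd a * b}"
  proof (intro equalityI subsetI)
    fix d assume "d \<in> {d. d dvd a * b}"
    then obtain x y where "d = x * y" "x dvd a" "y dvd b" using division_decomp by blast
    then show "d \<in> (\<lambda>(x,y). x * y) ` ?D" by (auto intro!: rev_image_eqI[of "(x, y)"])
  qed (auto intro: mult_dvd_mono)
  have "divisor_sum (a * b) = sum ((\<lambda>d. d) \<circ> (\<lambda>(x,y). x * y)) ?D"
    unfolding divisor_sum_def img[symmetric] by (rule sum.reindex[OF inj])
  also have "\<dots> = (\<Sum>(x,y)\<in>?D. x * y)" by (intro sum.cong refl) auto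
  also have "\<dots> = divisor_sum a * divisor_sum b"
    by (simp add: divisor_sum_def sum_product sum.cartesian_product)
  finally show ?thesis .
qed

lemma divisor_sum_prime: "prime p \<Longrightarrow> divisor_sum p = p + 1"
proof -
  assume p: "prime p"
  have "d dvd p \<longleftrightarrow> d = 1 \<or> d = p" for d
    using conjunct2[OF iffD1[OF prime_nat_iff p], rule_format, of d] by auto
  then have "{d. d dvd p} = {1, p}" by blast
  then show ?thesis using prime_gt_1_nat[OF p] by (simp add: divisor_sum_def)
qed

lemma divisor_sum_le_square: "divisor_sum n \<le> n * n"
proof (cases "n = 0")
  case False
  then have "{d. d dvd n} \<subseteq> {1..n}" by (auto intro!: Suc_leI gr0I dest: dvd_imp_le)
  then have "divisor_sum n \<le> (\<Sum>d\<in>{1..n}. d)" unfolding divisor_sum_def by (intro sum_mono2) auto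
  also have "\<dots> \<le> (\<Sum>d\<in>{1..n}. n)" by (intro sum_mono) auto
  finally show ?thesis by simp
qed (simp add: divisor_sum_def)

lemma aliquot_sum_le_square: "n > 0 \<Longrightarrow> aliquot_sum n \<le> n * n"
  using aliquot_sum_plus_self[of n] divisor_sum_le_square[of n] by linarith

lemma aliquot_sum_pos:
  assumes "m \<ge> 2"
  shows   "aliquot_sum m \<ge> 1"
proof -
  have "finite {d. d dvd m \<and> d < m}" by (rule finite_subset[of _ "{..<m}"]) auto
  then have "(\<Sum>d\<in>{1}. d) \<le> aliquot_sum m"
    unfolding aliquot_sum_def using assms by (intro sum_mono2) auto
  then show ?thesis by simp
qed

text \<open>The identity on which everything rests: for a fixed cofactor \<open>m\<close> the sum of proper divisors is a
  linear form in the prime \<open>P\<close>.\<close>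
lemma aliquot_sum_mult_prime:
  assumes "prime P" "\<not> P dvd m" "m > 0"
  shows   "aliquot_sum (m * P) = aliquot_sum m * P + divisor_sum m"
proof -
  have "coprime m P" using assms by (metis coprime_commute prime_imp_coprime)
  then have "divisor_sum (m * P) = divisor_sum m * (P + 1)"
    using assms by (simp add: divisor_sum_mult_coprime divisor_sum_prime)
  moreover have "aliquot_sum (m * P) + m * P = divisor_sum (m * P)"
    using assms by (intro aliquot_sum_plus_self) (auto simp: prime_gt_0_nat)
  moreover have "divisor_sum m * (P + 1) = aliquot_sum m * P + m * P + divisor_sum m"
    using aliquot_sum_plus_self[OF assms(3)] by (metis add_mult_distrib add_mult_distrib2 nat_mult_1_right)
  ultimately show ?thesis by linarith
qed

lemma prime_dvd_divisor_sum_prime_power: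
  assumes "prime p" "m > 0" "p dvd divisor_sum m"
  shows   "\<exists>q a. prime q \<and> a \<ge> 1 \<and> q ^ a dvd m \<and> p dvd divisor_sum (q ^ a)"
  using assms(2,3)
proof (induction m rule: less_induct)
  case (less m)
  show ?case
  proof (cases "m = 1")
    case True
    then have "divisor_sum m = 1" by (simp add: divisor_sum_def)
    then show ?thesis using less.prems assms(1) by auto
  next
    case False
    then obtain q where q: "prime q" "q dvd m" using prime_factor_nat by blast
    define a where "a = multiplicity q m"
    have a: "a \<ge> 1" using q less.prems unfolding a_def by (simp add: Suc_le_eq prime_multiplicity_gt_zero_iff)
    obtain k where k: "m = q ^ a * k" "\<not> q dvd k"
      using multiplicity_decompose'[of m q] q less.prems unfolding a_def by (metis not_prime_unit neq0_conv)
    have kpos: "k > 0" using k less.prems by (auto intro!: gr0I)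
    have "coprime (q ^ a) k" using k q by (simp add: prime_imp_coprime)
    then have "p dvd divisor_sum (q ^ a) \<or> p dvd divisor_sum k"
      using less.prems k assms(1) by (simp add: divisor_sum_mult_coprime prime_dvd_mult_iff)
    then show ?thesis
    proof
      assume "p dvd divisor_sum (q ^ a)"
      then show ?thesis using q a k by (intro exI[of _ q] exI[of _ a]) auto
    next
      assume *: "p dvd divisor_sum k"
      have "q ^ a > 1" using q a by (metis One_nat_def Suc_le_lessD one_less_power prime_gt_1_nat)
      then have "k < m" using k kpos by simp
      from less.IH[OF this kpos *] show ?thesis using k by (metis dvd_mult)
    qed
  qed
qed

text \<open>A prime \<open>p\<close> dividing $\sigma(m)$ divides $\sigma(q^a)$ for some prime power $q^a$ dividing \<open>m\<close>.  If
  $a = 1$, then $p \mid q + 1$ and $pq \mid m$.  If $a \ge 2$, then $q^a$ is at most the cube of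
  $q^{\lfloor a/2 \rfloor}$, whose square divides \<open>m\<close> and which is thus at most \<open>w\<close>, and
  $p \le \sigma(q^a) \le q^{2a} \le w^6$.\<close>
lemma prime_dvd_self_and_divisor_sum_le:
  assumes m: "m > 0"
    and sq: "\<And>k. k ^ 2 dvd m \<Longrightarrow> k \<le> w"
    and pq: "\<And>p q. prime p \<Longrightarrow> prime q \<Longrightarrow> p > w ^ 6 \<Longrightarrow> p dvd q + 1 \<Longrightarrow> \<not> p * q dvd m"
    and p: "prime p" "p dvd m" "p dvd divisor_sum m"
  shows "p \<le> w ^ 6"
proof (rule ccontr)
  assume big: "\<not> p \<le> w ^ 6"
  obtain q a where q: "prime q" "a \<ge> 1" "q ^ a dvd m" "p dvd divisor_sum (q ^ a)"
    using prime_dvd_divisor_sum_prime_power[OF p(1) m p(3)] by blast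
  show False
  proof (cases "a = 1")
    case True
    then have d: "p dvd q + 1" using q by (simp add: divisor_sum_prime)
    have "p \<noteq> q"
    proof
      assume "p = q"
      then have "p dvd 1" using d by (metis dvd_add_right_iff dvd_refl)
      then show False using p by auto
    qed
    then have "coprime p q" using p q by (simp add: primes_coprime)
    then have "p * q dvd m" using p q True by (simp add: divides_mult)
    then show False using pq[OF p(1) q(1) _ d] big by simp
  next
    case False
    define b where "b = a div 2"
    have b: "2 * b \<le> a" "a \<le> 3 * b" using False q(2) by (auto simp: b_def)
    have "(q ^ b) ^ 2 dvd q ^ a" using b by (simp add: power_mult[symmetric] le_imp_power_dvd mult.commute)
    then have "(q ^ b) ^ 2 dvd m" using q dvd_trans by blast
    then have qb: "q ^ b \<le> w" by (rule sq)
    have q1: "q \<ge> 1" using q(1) prime_gt_0_nat[of q] by simp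
    have "p \<le> divisor_sum (q ^ a)"
    proof (rule dvd_imp_le[OF q(4)])
      have "aliquot_sum (q ^ a) + q ^ a = divisor_sum (q ^ a)" using q1 by (intro aliquot_sum_plus_self) simp
      moreover have "q ^ a > 0" using q1 by simp
      ultimately show "divisor_sum (q ^ a) > 0" by linarith
    qed
    also have "\<dots> \<le> q ^ a * q ^ a" by (rule divisor_sum_le_square)
    also have "\<dots> = q ^ (2 * a)" by (simp add: mult_2 power_add)
    also have "\<dots> \<le> q ^ (6 * b)" using b q1 by (intro power_increasing) auto
    also have "\<dots> = (q ^ b) ^ 6" by (simp add: power_mult[symmetric] mult.commute)
    also have "\<dots> \<le> w ^ 6" using qb by (intro power_mono) auto
    finally show False using big by simp
  qed
qed

text \<open>A prime divisor \<open>p\<close> of $uP + v$ that divides one of \<open>u\<close>, \<open>v\<close> either divides both, hence also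
  $m = v - u$, or divides \<open>v\<close> and \<open>P\<close> and is equal to \<open>P\<close>.\<close>
lemma omega_aliquot_bounds:
  fixes m P y :: nat
  defines "u \<equiv> aliquot_sum m" and "v \<equiv> divisor_sum m"
  defines "f \<equiv> card {p. p \<in> primes_upto y \<and> \<not> p dvd u \<and> \<not> p dvd v \<and> p dvd u * P + v}"
  assumes P: "prime P" "\<not> P dvd m" and m: "m \<ge> 2"
  shows "f \<le> omega (aliquot_sum (m * P))"
    and "omega (aliquot_sum (m * P)) \<le> f + 1 + card {p. prime p \<and> p dvd m \<and> p dvd divisor_sum m}
           + card {p. prime p \<and> p > y \<and> p dvd aliquot_sum (m * P)}"
proof -
  have S: "aliquot_sum (m * P) = u * P + v"
    using aliquot_sum_mult_prime[OF P] m by (simp add: u_def v_def)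
  have uvm: "u + m = v" using aliquot_sum_plus_self[of m] m by (simp add: u_def v_def)
  have pos: "u * P + v > 0" using uvm m by linarith
  let ?F = "{p. p \<in> primes_upto y \<and> \<not> p dvd u \<and> \<not> p dvd v \<and> p dvd u * P + v}"
  let ?G = "{p. prime p \<and> p dvd m \<and> p dvd divisor_sum m}"
  let ?H = "{p. prime p \<and> p > y \<and> p dvd aliquot_sum (m * P)}"
  let ?O = "{p. prime p \<and> p dvd u * P + v}"
  have finO: "finite ?O" using pos by (intro finite_subset[of ?O "{..u * P + v}"]) (auto dest: dvd_imp_le)
  have finG: "finite ?G" using m by (intro finite_subset[of ?G "{..m}"]) (auto dest!: dvd_imp_le)
  have finH: "finite ?H" by (rule finite_subset[OF _ finO]) (auto simp: S)
  have "card ?F \<le> card ?O" by (intro card_mono finO) (auto simp: primes_upto_def)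
  then show "f \<le> omega (aliquot_sum (m * P))" by (simp add: f_def omega_def S)
  have "?O \<subseteq> (?F \<union> {P}) \<union> ?G \<union> ?H"
  proof
    fix p assume "p \<in> ?O"
    then have p: "prime p" "p dvd u * P + v" by auto
    have "p \<in> ?G" if "p dvd u" "p dvd v"
    proof -
      have "p dvd m" using that uvm by (metis dvd_add_right_iff)
      then show ?thesis using p that by (simp add: v_def)
    qed
    moreover have "p dvd v" if "p dvd u" using p that by (metis dvd_add_right_iff dvd_mult2)
    moreover have "p = P" if "p dvd v" "\<not> p dvd u"
    proof -
      have "p dvd u * P" using p that by (metis dvd_add_left_iff)
      then have "p dvd P" using p that prime_dvd_mult_iff by blast
      then show ?thesis using p P primes_dvd_imp_eq by blast
    qed
    moreover have "p \<in> ?F \<or> p \<in> ?H" if "\<not> p dvd u" "\<not> p dvd v"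
      using p that by (auto simp: primes_upto_def S)
    ultimately show "p \<in> (?F \<union> {P}) \<union> ?G \<union> ?H" by blast
  qed
  then have "card ?O \<le> card ((?F \<union> {P}) \<union> ?G \<union> ?H)"
    using finG finH by (intro card_mono) (auto simp: primes_upto_def)
  also have "\<dots> \<le> card (?F \<union> {P}) + card ?G + card ?H"
    by (meson add_le_mono1 card_Un_le le_trans)
  also have "card (?F \<union> {P}) \<le> card ?F + 1"
    using card_Un_le[of ?F "{P}"] by simp
  finally show "omega (aliquot_sum (m * P)) \<le> f + 1 + card ?G + card ?H"
    by (simp add: f_def omega_def S)
qed

lemma card_large_prime_divisors_le:
  assumes "n > 0" "y \<ge> 1"
  shows   "real (card {p. prime p \<and> p > y \<and> p dvd n}) * ln (real y + 1) \<le> ln (real n)"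
proof -
  have "real (card {p. prime p \<and> p > y \<and> p dvd n}) * ln (real y + 1)
      = (\<Sum>p | prime p \<and> p > y \<and> p dvd n. ln (real y + 1))" by simp
  also have "\<dots> \<le> (\<Sum>p | prime p \<and> p > y \<and> p dvd n. ln (real p))"
    by (intro sum_mono) auto
  also have "\<dots> \<le> (\<Sum>p\<in>prime_factors n. ln (real p))"
    using assms by (intro sum_mono2) (auto simp: prime_factors_dvd dest: prime_gt_0_nat)
  also have "\<dots> \<le> ln (real n)" by (rule sum_ln_prime_divisors_le) fact
  finally show ?thesis .
qed

section \<open>Rare sets of integers\<close>

lemma card_divisible_union_le:
  assumes "finite I" "\<And>i. i \<in> I \<Longrightarrow> g i > 0" "\<And>n. n \<in> A \<Longrightarrow> n \<in> {1..N} \<and> (\<exists>i\<in>I. g i dvd n)"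
  shows   "real (card A) \<le> real N * (\<Sum>i\<in>I. 1 / real (g i))"
proof -
  have "A \<subseteq> (\<Union>i\<in>I. {n\<in>{1..N}. g i dvd n})" using assms(3) by blast
  then have "card A \<le> card (\<Union>i\<in>I. {n\<in>{1..N}. g i dvd n})"
    using assms(1) by (intro card_mono) auto
  also have "\<dots> \<le> (\<Sum>i\<in>I. card {n\<in>{1..N}. g i dvd n})" using assms(1) by (rule card_UN_le)
  finally have "real (card A) \<le> (\<Sum>i\<in>I. real (card {n\<in>{1..N}. g i dvd n}))"
    by (metis of_nat_mono of_nat_sum)
  also have "\<dots> \<le> (\<Sum>i\<in>I. real N / real (g i))"
    using assms(2) by (intro sum_mono card_multiples_le) auto
  finally show ?thesis by (simp add: sum_distrib_left)
qed

lemma card_large_square_divisor_le: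
  assumes "w \<ge> 1"
  shows   "real (card {n\<in>{1..N}. \<exists>k>w. k ^ 2 dvd n}) \<le> real N / real w"
proof -
  have "real (card {n\<in>{1..N}. \<exists>k>w. k ^ 2 dvd n}) \<le> real N * (\<Sum>k\<in>{w<..N}. 1 / real (k ^ 2))"
  proof (rule card_divisible_union_le)
    fix n assume n: "n \<in> {n\<in>{1..N}. \<exists>k>w. k ^ 2 dvd n}"
    then obtain k where k: "k > w" "k ^ 2 dvd n" by auto
    have "k \<le> k ^ 2" by (simp add: power2_eq_square)
    also have "k ^ 2 \<le> n" using k n by (auto dest: dvd_imp_le)
    finally show "n \<in> {1..N} \<and> (\<exists>k\<in>{w<..N}. k ^ 2 dvd n)" using k n by auto
  qed auto
  also have "\<dots> \<le> real N * (1 / real w)"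
    using assms sum_inverse_squares_tail[of w "{w<..N}"] by (intro mult_left_mono) auto
  finally show ?thesis by simp
qed

text \<open>If \<open>n\<close> has no square divisor above $w^2$, its squarefree part is at least $n/w^2$, so
  $\sum_{p \mid n} \ln p \ge \ln n - 2 \ln w$.  If moreover all primes in this sum are at most \<open>z\<close>, this is far
  above its average over $n \le N$, which is $O(\ln z)$.\<close>
lemma card_smooth_le:
  fixes N w z :: nat
  assumes w: "w \<ge> 1" and z: "z \<ge> 1"
  defines "A \<equiv> {n\<in>{1..N}. N \<le> n ^ 2 \<and> (\<forall>k. k ^ 2 dvd n \<longrightarrow> k \<le> w) \<and> (\<forall>p. prime p \<longrightarrow> p dvd n \<longrightarrow> p \<le> z)}"
  shows   "real (card A) * (ln (real N) / 2 - 2 * ln (real w)) \<le> 2 * real N * ln (real z)"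
proof -
  let ?g = "\<lambda>n. \<Sum>p | p \<in> primes_upto z \<and> p dvd n. ln (real p)"
  have g0: "?g n \<ge> 0" for n by (intro sum_nonneg) (auto simp: primes_upto_def dest!: prime_ge_1_nat)
  have "real (card A) * (ln (real N) / 2 - 2 * ln (real w)) = (\<Sum>n\<in>A. ln (real N) / 2 - 2 * ln (real w))"
    by simp
  also have "\<dots> \<le> (\<Sum>n\<in>A. ?g n)"
  proof (intro sum_mono)
    fix n assume n: "n \<in> A"
    then have n1: "n \<ge> 1" "N \<ge> 1" by (auto simp: A_def)
    define a b where "a = squarefree_part n" and "b = square_part n"
    have dec: "n = a * b ^ 2" unfolding a_def b_def by (rule squarefree_decompose)
    have ab: "a > 0" "b > 0" using dec n1 by (auto intro!: gr0I)
    have "b ^ 2 dvd n" unfolding b_def by blast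
    then have "b \<le> w" using n by (auto simp: A_def)
    then have lb: "ln (real b) \<le> ln (real w)" using ab by simp
    have "real N \<le> real n ^ 2" using n by (auto simp: A_def of_nat_le_iff simp flip: of_nat_power)
    then have "ln (real N) \<le> ln (real n ^ 2)" using n1 by (intro ln_mono) auto
    then have "ln (real N) / 2 \<le> ln (real n)" using n1 by (simp add: ln_realpow)
    also have "real n = real a * real b ^ 2" using dec by (metis of_nat_mult of_nat_power)
    also have "ln \<dots> = ln (real a) + 2 * ln (real b)" using ab by (simp add: ln_mult ln_realpow)
    also have "ln (real a) = (\<Sum>p\<in>prime_factors a. ln (real p))"
    proof -
      have "a = \<Prod>(prime_factors a)"
        by (rule squarefree_eq_prod_prime_factors) (auto simp: a_def)
      then have "real a = real (\<Prod>(prime_factors a))" by (rule arg_cong)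
      also have "\<dots> = (\<Prod>p\<in>prime_factors a. real p)" by simp
      finally have "ln (real a) = ln (\<Prod>p\<in>prime_factors a. real p)" by (rule arg_cong)
      also have "\<dots> = (\<Sum>p\<in>prime_factors a. ln (real p))"
        by (intro ln_prod) (auto dest: in_prime_factors_imp_prime prime_gt_0_nat)
      finally show ?thesis .
    qed
    also have "\<dots> \<le> ?g n"
    proof (intro sum_mono2)
      show "prime_factors a \<subseteq> {p. p \<in> primes_upto z \<and> p dvd n}"
        using n ab dec by (auto simp: primes_upto_def prime_factors_dvd A_def)
    qed (auto simp: primes_upto_def dest!: prime_ge_1_nat)
    finally show "ln (real N) / 2 - 2 * ln (real w) \<le> ?g n" using lb by linarith
  qed
  also have "\<dots> \<le> (\<Sum>n=1..N. ?g n)" using g0 by (intro sum_mono2) (auto simp: A_def)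
  also have "\<dots> = (\<Sum>p\<in>primes_upto z. real (N div p) * ln (real p))"
    by (rule sum_over_prime_divisors) (auto simp: primes_upto_def prime_gt_0_nat)
  also have "\<dots> \<le> (\<Sum>p\<in>primes_upto z. real N / real p * ln (real p))"
    by (intro sum_mono mult_right_mono of_nat_div_le_of_nat)
       (auto simp: primes_upto_def dest!: prime_ge_1_nat)
  also have "\<dots> = real N * (\<Sum>p\<in>primes_upto z. ln (real p) / real p)" by (simp add: sum_distrib_left)
  also have "\<dots> \<le> real N * (2 * ln (real z))"
    using z by (intro mult_left_mono sum_ln_over_primes_le) auto
  finally show ?thesis by simp
qed

lemma card_small_squares_le: "real (card {n\<in>{1..N}. n ^ 2 < N}) \<le> sqrt (real N)"
proof -
  have "{n\<in>{1..N}. n ^ 2 < N} \<subseteq> {1..nat \<lfloor>sqrt (real N)\<rfloor>}"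
  proof safe
    fix n assume "n ^ 2 < N" "n \<in> {1..N}"
    then have "real n ^ 2 \<le> real N" by (metis less_imp_le of_nat_le_iff of_nat_power)
    then have "real n \<le> sqrt (real N)" by (rule real_le_rsqrt)
    then show "n \<in> {1..nat \<lfloor>sqrt (real N)\<rfloor>}" using \<open>n \<in> {1..N}\<close> by (auto simp: le_nat_floor)
  qed
  then have "card {n\<in>{1..N}. n ^ 2 < N} \<le> card {1..nat \<lfloor>sqrt (real N)\<rfloor>}" by (intro card_mono) auto
  also have "\<dots> = nat \<lfloor>sqrt (real N)\<rfloor>" by simp
  finally have "real (card {n\<in>{1..N}. n ^ 2 < N}) \<le> real (nat \<lfloor>sqrt (real N)\<rfloor>)" by (rule of_nat_mono)
  also have "\<dots> \<le> sqrt (real N)" by (simp add: of_nat_floor)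
  finally show ?thesis .
qed

lemma card_many_small_primes_le:
  assumes "w \<ge> 3"
  shows   "real (card {n\<in>{1..N}. c \<le> real (card {p. p \<in> primes_upto w \<and> p dvd n})}) * c
             \<le> real N * (ln (ln (real w)) + 5)"
proof -
  let ?A = "{n\<in>{1..N}. c \<le> real (card {p. p \<in> primes_upto w \<and> p dvd n})}"
  let ?g = "\<lambda>n. \<Sum>p | p \<in> primes_upto w \<and> p dvd n. 1::real"
  have "real (card ?A) * c = (\<Sum>n\<in>?A. c)" by simp
  also have "\<dots> \<le> (\<Sum>n\<in>?A. ?g n)" by (intro sum_mono) auto
  also have "\<dots> \<le> (\<Sum>n=1..N. ?g n)" by (intro sum_mono2) auto
  also have "\<dots> = (\<Sum>p\<in>primes_upto w. real (N div p) * 1)"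
    by (rule sum_over_prime_divisors) (auto simp: primes_upto_def prime_gt_0_nat)
  also have "\<dots> \<le> (\<Sum>p\<in>primes_upto w. real N / real p * 1)"
    by (intro sum_mono mult_right_mono of_nat_div_le_of_nat) auto
  also have "\<dots> = real N * (\<Sum>p\<in>primes_upto w. 1 / real p)" by (simp add: sum_distrib_left)
  also have "\<dots> \<le> real N * (ln (ln (real w)) + 5)"
    using assms by (intro mult_left_mono sum_inverse_primes_le) auto
  finally show ?thesis .
qed

text \<open>Writing $q = pj - 1$, the count is at most $\sum_{p > w} \sum_j N / (p (pj - 1))$, where $j \le N$
  because $2j \le pj = q + 1 \le 2q \le pq \le N$.\<close>
lemma card_linked_primes_le:
  assumes w: "w \<ge> 1" and N: "N \<ge> 1"
  shows "real (card {n\<in>{1..N}. \<exists>p q. prime p \<and> prime q \<and> p > w \<and> p dvd q + 1 \<and> p * q dvd n})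
           \<le> 2 * real N * (1 + ln (real N)) / real w"
proof -
  let ?I = "{w<..N} \<times> {1..N}" and ?g = "\<lambda>(p,j). p * (p * j - 1)"
  have pj: "p * j \<ge> 2" if "(p, j) \<in> ?I" for p j
  proof -
    have "2 * 1 \<le> p * j" using that w by (intro mult_le_mono) auto
    then show ?thesis by simp
  qed
  have union: "real (card {n\<in>{1..N}. \<exists>p q. prime p \<and> prime q \<and> p > w \<and> p dvd q + 1 \<and> p * q dvd n})
          \<le> real N * (\<Sum>i\<in>?I. 1 / real (?g i))"
  proof (rule card_divisible_union_le)
    show "?g i > 0" if "i \<in> ?I" for i
      using that pj by (cases i) (force simp: less_diff_conv)
    fix n assume n: "n \<in> {n\<in>{1..N}. \<exists>p q. prime p \<and> prime q \<and> p > w \<and> p dvd q + 1 \<and> p * q dvd n}"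
    then obtain p q where pq: "prime p" "prime q" "p > w" "p dvd q + 1" "p * q dvd n" by auto
    obtain j where j: "q + 1 = p * j" using pq by auto
    have "p * q \<le> n" using pq n by (auto dest: dvd_imp_le)
    then have pqN: "p * q \<le> N" using n by auto
    have q2: "q \<ge> 2" "p \<ge> 2" using pq prime_ge_2_nat by auto
    have "p \<le> p * q" using q2 by simp
    then have "p \<le> N" using pqN by (rule order_trans)
    have "2 * j \<le> p * j" using q2 by simp
    also have "p * j \<le> 2 * q" using j q2 by linarith
    also have "\<dots> \<le> p * q" using q2 by simp
    finally have "j \<le> N" using pqN by linarith
    moreover have "j \<ge> 1" using j by (auto intro!: Suc_leI gr0I)
    moreover have "p * j - 1 = q" using j by simp
    ultimately show "n \<in> {1..N} \<and> (\<exists>i\<in>?I. ?g i dvd n)"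
      using n pq \<open>p \<le> N\<close> by (intro conjI bexI[of _ "(p, j)"]) auto
  qed auto
  have "(\<Sum>i\<in>?I. 1 / real (?g i)) \<le> (\<Sum>(p,j)\<in>?I. 2 * (1 / real p ^ 2 * (1 / real j)))"
  proof (intro sum_mono)
    fix i assume i: "i \<in> ?I"
    obtain p j where pjd: "i = (p, j)" by (cases i)
    then have 2: "p * j \<ge> 2" "p > 0" "j > 0" using pj i w by auto
    define k where "k = p * j - 1"
    have "p * j \<le> 2 * k" "k \<ge> 1" using 2 by (auto simp: k_def)
    then have "real (p * j) \<le> real (2 * k)" "real k > 0" by (intro of_nat_mono, simp_all)
    then have "real p * (real (p * j) / 2) \<le> real p * real k"
      by (intro mult_left_mono) auto
    then have "1 / (real p * real k) \<le> 1 / (real p * (real (p * j) / 2))"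
      using 2 \<open>real k > 0\<close> by (intro divide_left_mono mult_pos_pos) auto
    also have "\<dots> = 2 * (1 / real p ^ 2 * (1 / real j))" by (simp add: power2_eq_square)
    finally show "1 / real (?g i) \<le> (case i of (p,j) \<Rightarrow> 2 * (1 / real p ^ 2 * (1 / real j)))"
      by (simp add: pjd k_def)
  qed
  also have "\<dots> = 2 * ((\<Sum>p\<in>{w<..N}. 1 / real p ^ 2) * (\<Sum>j=1..N. 1 / real j))"
  proof -
    have eq: "(\<Sum>p\<in>{w<..N}. 1 / real p ^ 2) * (\<Sum>j=1..N. 1 / real j) = (\<Sum>(p,j)\<in>?I. 1 / real p ^ 2 * (1 / real j))"
      unfolding sum_product sum.cartesian_product ..
    show ?thesis by (subst eq, subst sum_distrib_left, intro sum.cong refl) auto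
  qed
  also have "\<dots> \<le> 2 * (1 / real w * (1 + ln (real N)))"
    using w N sum_inverse_squares_tail[of w "{w<..N}"]
    by (intro mult_left_mono mult_mono harmonic_le_ln) (auto intro: sum_nonneg)
  finally have "real N * (\<Sum>i\<in>?I. 1 / real (?g i)) \<le> real N * (2 * (1 / real w * (1 + ln (real N))))"
    by (intro mult_left_mono) auto
  also have "\<dots> = 2 * real N * (1 + ln (real N)) / real w" by simp
  finally show ?thesis using union by linarith
qed

section \<open>The fibres of numbers with a fixed cofactor\<close>

text \<open>Only for these primes is divisibility of $s(m) P + \sigma(m)$ by \<open>p\<close> a congruence for \<open>P\<close> modulo \<open>p\<close>
  to a class coprime to \<open>p\<close>.\<close>
definition fibre_primes :: "nat \<Rightarrow> nat \<Rightarrow> nat set" where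
  "fibre_primes y m = {p \<in> primes_upto y. \<not> p dvd aliquot_sum m \<and> \<not> p dvd divisor_sum m}"

definition fibre_count :: "nat \<Rightarrow> nat \<Rightarrow> nat \<Rightarrow> real" where
  "fibre_count y m P =
     real (card {p \<in> fibre_primes y m. p dvd aliquot_sum m * P + divisor_sum m})"

definition fibre_mean :: "nat \<Rightarrow> nat \<Rightarrow> real" where
  "fibre_mean y m = (\<Sum>p\<in>fibre_primes y m. 1 / (real p - 1))"

lemma finite_fibre_primes [simp]: "finite (fibre_primes y m)"
  by (rule finite_subset[of _ "primes_upto y"]) (auto simp: fibre_primes_def)

lemma fibre_mean_nonneg: "fibre_mean y m \<ge> 0"
  unfolding fibre_mean_def
  by (intro sum_nonneg) (auto simp: fibre_primes_def primes_upto_def dest: prime_ge_1_nat)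

lemma fibre_mean_le:
  assumes "3 \<le> y" "y \<le> N"
  shows   "fibre_mean y m \<le> ln (ln (real N)) + 9"
proof -
  have "fibre_mean y m \<le> (\<Sum>p\<in>primes_upto N. 1 / (real p - 1))"
    unfolding fibre_mean_def using assms
    by (intro sum_mono2) (auto simp: fibre_primes_def primes_upto_def dest: prime_ge_1_nat)
  also have "\<dots> \<le> ln (ln (real N)) + 9"
    using assms by (intro sum_inverse_primes_minus_one_le) auto
  finally show ?thesis .
qed

text \<open>The omitted primes divide $s(m) \sigma(m) \le N^4$, so their reciprocals have a small sum.\<close>
lemma fibre_mean_ge:
  assumes y: "2 \<le> y" and m: "2 \<le> m" "m \<le> N" and K: "N ^ 4 \<le> 2 ^ K" "K \<ge> 3"
  shows   "ln (ln (real y)) - 11 - ln (ln (real K)) \<le> fibre_mean y m"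
proof -
  define u v where "u = aliquot_sum m" and "v = divisor_sum m"
  have u: "u \<ge> 1" using aliquot_sum_pos[OF m(1)] by (simp add: u_def)
  have uv: "u + m = v" using aliquot_sum_plus_self[of m] m by (simp add: u_def v_def)
  have v: "v \<ge> 1" using uv u by linarith
  have "u * v \<le> (m * m) * (m * m)"
    using aliquot_sum_le_square[of m] divisor_sum_le_square[of m] m by (intro mult_le_mono) (auto simp: u_def v_def)
  also have "\<dots> = m ^ 4" by (simp add: power4_eq_xxxx)
  also have "\<dots> \<le> N ^ 4" using m by (intro power_mono) auto
  finally have uvK: "u * v \<le> 2 ^ K" using K by simp
  have uv0: "u * v > 0" using u v by simp
  let ?B = "{p \<in> primes_upto y. p dvd u * v}"
  have split: "primes_upto y = fibre_primes y m \<union> ?B"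
    by (auto simp: fibre_primes_def primes_upto_def u_def v_def prime_dvd_mult_iff)
  have "ln (ln (real y)) - 1 \<le> (\<Sum>p\<in>primes_upto y. 1 / real p)" by (rule sum_inverse_primes_ge[OF y])
  also have "\<dots> = (\<Sum>p\<in>fibre_primes y m. 1 / real p) + (\<Sum>p\<in>?B. 1 / real p)"
    by (subst split, rule sum.union_disjoint)
       (auto simp: fibre_primes_def primes_upto_def u_def v_def prime_dvd_mult_iff)
  also have "(\<Sum>p\<in>fibre_primes y m. 1 / real p) \<le> fibre_mean y m"
    unfolding fibre_mean_def
  proof (intro sum_mono)
    fix p assume "p \<in> fibre_primes y m"
    then have "p \<ge> 2" by (auto simp: fibre_primes_def primes_upto_def prime_ge_2_nat)
    then show "1 / real p \<le> 1 / (real p - 1)" by (intro divide_left_mono mult_pos_pos) auto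
  qed
  also have "(\<Sum>p\<in>?B. 1 / real p) \<le> (\<Sum>p\<in>?B. 1 / (real p - 1))"
  proof (intro sum_mono)
    fix p assume "p \<in> ?B"
    then have "p \<ge> 2" by (auto simp: primes_upto_def prime_ge_2_nat)
    then show "1 / real p \<le> 1 / (real p - 1)" by (intro divide_left_mono mult_pos_pos) auto
  qed
  also have "\<dots> \<le> (\<Sum>p\<in>prime_factors (u * v). 1 / (real p - 1))"
    using uv0
    by (intro sum_mono2) (auto simp: primes_upto_def prime_factors_dvd dest: in_prime_factors_imp_prime prime_ge_1_nat)
  also have "\<dots> \<le> ln (ln (real K)) + 10"
    by (intro sum_prime_divisors_inverse_le uv0 uvK K)
  finally show ?thesis by simp
qed

lemma card_exceptional_fibre_le:
  assumes m: "2 \<le> m" and N: "N \<le> 2 ^ K" "K \<ge> 3" and y: "3 \<le> y" "y \<le> N" and R: "R \<ge> 1" and c: "c \<ge> 0"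
    and G: "G = ln (ln (real K)) + 10" "G \<ge> 0" and M: "M = ln (ln (real N)) + 9"
  shows "real (card {P\<in>{1..N div m}. prime P \<and> P > R \<and> c \<le> \<bar>fibre_count y m P - fibre_mean y m\<bar>}) * c ^ 2
     \<le> (2 * (real N / real m) / ln (real R + 1) + real R ^ 4) * (M * (1 + 2 * G)) + 6 * real R ^ 4 * real y ^ 2"
proof -
  let ?X = "N div m" and ?Q = "fibre_primes y m" and ?M = "fibre_mean y m"
  let ?u = "aliquot_sum m" and ?v = "divisor_sum m"
  have prQ: "prime p" "\<not> p dvd ?u" "\<not> p dvd ?v" if "p \<in> ?Q" for p
    using that by (auto simp: fibre_primes_def primes_upto_def)
  have Gn: "(\<Sum>p | p \<in> ?Q \<and> p dvd n. 1 / (real p - 1)) \<le> G" if n: "n \<in> {1..?X}" for n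
  proof -
    have "n \<le> N" using n by (meson atLeastAtMost_iff div_le_dividend le_trans)
    have "(\<Sum>p | p \<in> ?Q \<and> p dvd n. 1 / (real p - 1)) \<le> (\<Sum>p\<in>prime_factors n. 1 / (real p - 1))"
      using n by (intro sum_mono2)
        (auto simp: fibre_primes_def primes_upto_def prime_factors_dvd dest: in_prime_factors_imp_prime prime_ge_1_nat)
    also have "\<dots> \<le> G" unfolding G(1)
      using n N \<open>n \<le> N\<close> by (intro sum_prime_divisors_inverse_le) auto
    finally show ?thesis .
  qed
  have MM: "?M \<le> M" unfolding M by (rule fibre_mean_le[OF y])
  have cardQ: "card ?Q \<le> y"
  proof -
    have "card ?Q \<le> card {1..y}"
      by (intro card_mono) (auto simp: fibre_primes_def primes_upto_def prime_ge_Suc_0_nat)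
    then show ?thesis by simp
  qed
  have lnR: "ln (real R + 1) > 0" using R by simp
  have "real (card {P\<in>{1..?X}. prime P \<and> P > R \<and> c \<le> \<bar>fibre_count y m P - ?M\<bar>}) * c ^ 2
     \<le> (2 * real ?X / ln (real R + 1) + real R ^ 4) * (?M + 2 * ?M * G) + 6 * real R ^ 4 * real (card ?Q) ^ 2"
    unfolding fibre_count_def fibre_mean_def
    by (rule card_primes_exceptional_le) (use prQ Gn G R c in auto)
  also have "\<dots> = (2 * real ?X / ln (real R + 1) + real R ^ 4) * (?M * (1 + 2 * G)) + 6 * real R ^ 4 * real (card ?Q) ^ 2"
    by (simp add: algebra_simps)
  also have "\<dots> \<le> (2 * (real N / real m) / ln (real R + 1) + real R ^ 4) * (M * (1 + 2 * G)) + 6 * real R ^ 4 * real y ^ 2"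
    using lnR MM cardQ G(2) fibre_mean_nonneg[of y m]
    by (intro add_mono mult_mono mult_left_mono divide_right_mono power_mono add_right_mono of_nat_div_le_of_nat)
       (auto intro!: mult_nonneg_nonneg add_nonneg_nonneg divide_nonneg_nonneg)
  finally show ?thesis .
qed

definition exceptional_on_fibre :: "nat \<Rightarrow> nat \<Rightarrow> real \<Rightarrow> nat \<Rightarrow> bool" where
  "exceptional_on_fibre z y c n \<longleftrightarrow> (\<exists>m P. n = m * P \<and> prime P \<and> P > z \<and> m \<ge> 2 \<and>
      c \<le> \<bar>fibre_count y m P - fibre_mean y m\<bar>)"

text \<open>The cofactors satisfy $m \le N/z$.  Summing the bound for one fibre over them replaces $1/m$ by a
  harmonic sum, and each error term occurs at most $N/z$ times.\<close>
lemma card_exceptional_on_fibres_le: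
  assumes N: "N \<le> 2 ^ K" "K \<ge> 3" and y: "3 \<le> y" "y \<le> N" and R: "R \<ge> 1" "R \<le> z" and c: "c \<ge> 0"
    and G: "G = ln (ln (real K)) + 10" "G \<ge> 0" and M: "M = ln (ln (real N)) + 9"
  shows "real (card {n\<in>{1..N}. exceptional_on_fibre z y c n}) * c ^ 2
     \<le> (2 * real N * (1 + ln (real N)) / ln (real R + 1) + real N / real z * real R ^ 4) * (M * (1 + 2 * G))
         + real N / real z * (6 * real R ^ 4 * real y ^ 2)"
proof -
  let ?F = "\<lambda>m. {P\<in>{1..N div m}. prime P \<and> P > R \<and> c \<le> \<bar>fibre_count y m P - fibre_mean y m\<bar>}"
  let ?A = "{n\<in>{1..N}. exceptional_on_fibre z y c n}"
  let ?I = "{2..N div z}"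
  have z: "z \<ge> 1" using R by simp
  have M0: "M \<ge> 0" using fibre_mean_nonneg[of y 2] fibre_mean_le[OF y, of 2] by (simp add: M)
  have lnR: "ln (real R + 1) > 0" using R by simp
  have sub: "?A \<subseteq> (\<Union>m\<in>?I. (\<lambda>P. m * P) ` ?F m)"
  proof
    fix n assume n: "n \<in> ?A"
    then obtain m P where mP: "n = m * P" "prime P" "P > z" "m \<ge> 2" "c \<le> \<bar>fibre_count y m P - fibre_mean y m\<bar>"
      by (auto simp: exceptional_on_fibre_def)
    have le: "m * P \<le> N" using n mP by simp
    have "m * z \<le> m * P" using mP by simp
    then have "m * z \<le> N" using le by linarith
    then have "m \<in> ?I" using mP z by (simp add: less_eq_div_iff_mult_less_eq)
    moreover have "P \<in> ?F m"
      using mP R le prime_gt_0_nat[OF mP(2)] by (simp add: less_eq_div_iff_mult_less_eq mult.commute Suc_le_eq)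
    ultimately show "n \<in> (\<Union>m\<in>?I. (\<lambda>P. m * P) ` ?F m)" using mP(1) by blast
  qed
  have "card ?A \<le> card (\<Union>m\<in>?I. (\<lambda>P. m * P) ` ?F m)" by (intro card_mono sub) auto
  also have "\<dots> \<le> (\<Sum>m\<in>?I. card ((\<lambda>P. m * P) ` ?F m))" by (intro card_UN_le) auto
  also have "\<dots> \<le> (\<Sum>m\<in>?I. card (?F m))" by (intro sum_mono card_image_le) auto
  finally have "real (card ?A) \<le> real (\<Sum>m\<in>?I. card (?F m))" by (rule of_nat_mono)
  also have "\<dots> = (\<Sum>m\<in>?I. real (card (?F m)))" by (rule of_nat_sum)
  finally have "real (card ?A) * c ^ 2 \<le> (\<Sum>m\<in>?I. real (card (?F m))) * c ^ 2" by (intro mult_right_mono) auto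
  also have "\<dots> = (\<Sum>m\<in>?I. real (card (?F m)) * c ^ 2)" by (rule sum_distrib_right)
  also have "\<dots> \<le> (\<Sum>m\<in>?I. (2 * (real N / real m) / ln (real R + 1) + real R ^ 4) * (M * (1 + 2 * G)) + 6 * real R ^ 4 * real y ^ 2)"
    using card_exceptional_fibre_le[OF _ N y R(1) c G M] by (intro sum_mono) auto
  also have "\<dots> = (2 * real N / ln (real R + 1) * (\<Sum>m\<in>?I. 1 / real m) + real (card ?I) * real R ^ 4) * (M * (1 + 2 * G))
                  + real (card ?I) * (6 * real R ^ 4 * real y ^ 2)"
  proof -
    have "(\<Sum>m\<in>?I. 2 * (real N / real m) / ln (real R + 1)) = 2 * real N / ln (real R + 1) * (\<Sum>m\<in>?I. 1 / real m)"
      unfolding sum_distrib_left by (intro sum.cong refl) simp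
    then show ?thesis by (simp add: sum.distrib sum_distrib_right[symmetric])
  qed
  also have "\<dots> \<le> (2 * real N / ln (real R + 1) * (1 + ln (real N)) + real N / real z * real R ^ 4) * (M * (1 + 2 * G))
                  + real N / real z * (6 * real R ^ 4 * real y ^ 2)"
  proof -
    have "(\<Sum>m\<in>?I. 1 / real m) \<le> (\<Sum>m=1..N. 1 / real m)"
      by (intro sum_mono2) (auto intro: order_trans[OF _ div_le_dividend])
    also have "\<dots> \<le> 1 + ln (real N)" using y by (intro harmonic_le_ln) auto
    finally have h: "(\<Sum>m\<in>?I. 1 / real m) \<le> 1 + ln (real N)" .
    have "card ?I \<le> N div z" by simp
    then have "real (card ?I) \<le> real (N div z)" by (rule of_nat_mono)
    also have "\<dots> \<le> real N / real z" by (rule of_nat_div_le_of_nat)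
    finally have i: "real (card ?I) \<le> real N / real z" .
    show ?thesis
      using h i lnR M0 G(2) by (intro add_mono mult_right_mono mult_left_mono) auto
  qed
  finally show ?thesis by simp
qed

text \<open>The hypotheses exclude all rare sets.  They provide a factorisation $n = mP$ with $P > z$ and
  $P \nmid m$, as otherwise $P^2$ would be a large square divisor.  The prime divisors of $s(n)$ are then
  split as in \<open>omega_aliquot_bounds\<close>: those counted on the fibre deviate by less than \<open>c\<close> from their
  mean, the common divisors of \<open>m\<close> and $\sigma(m)$ are among the fewer than \<open>t\<close> small prime factors of
  \<open>n\<close>, and at most $\ln s(n) / \ln (y+1)$ exceed \<open>y\<close>.\<close>
lemma omega_aliquot_sum_regular:
  assumes n: "n \<in> {1..N}" "N \<le> n ^ 2" "\<not> prime n"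
    and sq: "\<And>k. k ^ 2 dvd n \<Longrightarrow> k \<le> w"
    and rough: "\<not> (\<forall>p. prime p \<longrightarrow> p dvd n \<longrightarrow> p \<le> z)"
    and few: "real (card {p. p \<in> primes_upto (w ^ 6) \<and> p dvd n}) < t"
    and link: "\<And>p q. prime p \<Longrightarrow> prime q \<Longrightarrow> p > w ^ 6 \<Longrightarrow> p dvd q + 1 \<Longrightarrow> \<not> p * q dvd n"
    and reg: "\<not> exceptional_on_fibre z y c n"
    and wz: "w \<le> z" and y: "3 \<le> y" "y \<le> N" and K: "N ^ 4 \<le> 2 ^ K" "K \<ge> 3"
  shows "real z < real (aliquot_sum n)" "real (aliquot_sum n) \<le> real N ^ 2"
    and "ln (ln (real y)) - 11 - ln (ln (real K)) - c \<le> real (omega (aliquot_sum n))"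
    and "real (omega (aliquot_sum n)) \<le> ln (ln (real N)) + 10 + c + t + 2 * ln (real N) / ln (real y + 1)"
proof -
  obtain P where P: "prime P" "P dvd n" "P > z" using rough by (meson not_le)
  then obtain m where m: "n = m * P" by (metis dvd_def mult.commute)
  have Pm: "\<not> P dvd m"
  proof
    assume "P dvd m"
    then have "P ^ 2 dvd n" using m by (simp add: power2_eq_square mult_dvd_mono)
    then have "P \<le> w" by (rule sq)
    then show False using P wz by simp
  qed
  have m2: "m \<ge> 2"
  proof -
    have "m \<noteq> 0" using m n by (intro notI) simp
    moreover have "m \<noteq> 1" using m n P by auto
    ultimately show ?thesis by simp
  qed
  have mn: "m dvd n" "m \<le> N"
    using m n prime_gt_0_nat[OF P(1)] by (auto intro: order_trans[of _ "m * P"])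
  let ?S = "aliquot_sum n"
  have S: "?S = aliquot_sum m * P + divisor_sum m"
    unfolding m using P Pm m2 by (intro aliquot_sum_mult_prime) auto
  have "P \<le> aliquot_sum m * P" using aliquot_sum_pos[OF m2] by simp
  then have "z < ?S" using S P by linarith
  then show z: "real z < real ?S" by simp
  have "?S \<le> n * n" using n by (intro aliquot_sum_le_square) auto
  also have "\<dots> \<le> N ^ 2" using n by (simp add: power2_eq_square mult_le_mono)
  finally have "real ?S \<le> real (N ^ 2)" by (rule of_nat_mono)
  then show SN: "real ?S \<le> real N ^ 2" by simp
  have dev: "\<bar>fibre_count y m P - fibre_mean y m\<bar> < c"
  proof (rule ccontr)
    assume "\<not> ?thesis"
    then have "exceptional_on_fibre z y c n"
      unfolding exceptional_on_fibre_def using m P m2 by (intro exI[of _ m] exI[of _ P]) auto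
    then show False using reg by simp
  qed
  have fc: "fibre_count y m P = real (card {p. p \<in> primes_upto y \<and> \<not> p dvd aliquot_sum m \<and> \<not> p dvd divisor_sum m
      \<and> p dvd aliquot_sum m * P + divisor_sum m})"
    unfolding fibre_count_def fibre_primes_def by (intro arg_cong[where f = "\<lambda>A. real (card A)"]) auto
  have "fibre_count y m P \<le> real (omega ?S)"
    unfolding fc m by (intro of_nat_mono omega_aliquot_bounds(1) P Pm m2)
  moreover have "ln (ln (real y)) - 11 - ln (ln (real K)) \<le> fibre_mean y m"
    using y m2 mn K by (intro fibre_mean_ge) auto
  ultimately show "ln (ln (real y)) - 11 - ln (ln (real K)) - c \<le> real (omega ?S)"
    using dev by linarith
  let ?G = "{p. prime p \<and> p dvd m \<and> p dvd divisor_sum m}" and ?H = "{p. prime p \<and> p > y \<and> p dvd aliquot_sum (m * P)}"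
  have "real (omega ?S) \<le> fibre_count y m P + 1 + real (card ?G) + real (card ?H)"
    using of_nat_mono[OF omega_aliquot_bounds(2)[OF P(1) Pm m2, of y], where 'a = real]
    by (simp add: fc m)
  moreover have "real (card ?G) < t"
  proof -
    have "?G \<subseteq> {p. p \<in> primes_upto (w ^ 6) \<and> p dvd n}"
    proof
      fix p assume p: "p \<in> ?G"
      have "p \<le> w ^ 6"
        using m2 sq link p mn(1)
        by (intro prime_dvd_self_and_divisor_sum_le[of m w p]) (auto dest: dvd_trans)
      then show "p \<in> {p. p \<in> primes_upto (w ^ 6) \<and> p dvd n}"
        using p mn(1) by (auto simp: primes_upto_def dest: dvd_trans)
    qed
    then have "card ?G \<le> card {p. p \<in> primes_upto (w ^ 6) \<and> p dvd n}" by (intro card_mono) auto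
    then show ?thesis using few by linarith
  qed
  moreover have "real (card ?H) \<le> 2 * ln (real N) / ln (real y + 1)"
  proof -
    have "?S > 0" using \<open>z < ?S\<close> by simp
    then have "real (card ?H) * ln (real y + 1) \<le> ln (real ?S)"
      unfolding m using y by (intro card_large_prime_divisors_le) auto
    also have "\<dots> \<le> ln (real N ^ 2)" using SN \<open>?S > 0\<close> by (intro ln_mono) auto
    also have "\<dots> = 2 * ln (real N)" using y by (simp add: ln_realpow)
    finally show ?thesis using y by (simp add: pos_le_divide_eq)
  qed
  moreover have "fibre_mean y m \<le> ln (ln (real N)) + 9" by (rule fibre_mean_le[OF y])
  ultimately show "real (omega ?S) \<le> ln (ln (real N)) + 10 + c + t + 2 * ln (real N) / ln (real y + 1)"
    using dev by linarith
qed

section \<open>Choice of the cutoffs and conclusion\<close>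

lemma card_primes_upto_le:
  assumes "R \<ge> 1"
  shows "real (card {n\<in>{1..N}. prime n}) \<le> 2 * real N / ln (real R + 1) + real R ^ 4 + real R"
proof -
  have "{n\<in>{1..N}. prime n} \<subseteq> {P\<in>{1..N}. prime P \<and> P > R} \<union> {1..R}" by auto
  then have "card {n\<in>{1..N}. prime n} \<le> card ({P\<in>{1..N}. prime P \<and> P > R} \<union> {1..R})"
    by (intro card_mono) auto
  also have "\<dots> \<le> card {P\<in>{1..N}. prime P \<and> P > R} + card {1..R}" by (rule card_Un_le)
  finally show ?thesis using card_primes_le[OF assms, of N] by simp
qed

lemma nat_floor_bounds:
  fixes a :: real
  assumes "a \<ge> 1"
  shows "real (nat \<lfloor>a\<rfloor>) \<le> a" "a < real (nat \<lfloor>a\<rfloor>) + 1" "a / 2 \<le> real (nat \<lfloor>a\<rfloor>)" "nat \<lfloor>a\<rfloor> \<ge> 1"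
proof -
  have f: "\<lfloor>a\<rfloor> \<ge> 1" using assms by simp
  then have r: "real (nat \<lfloor>a\<rfloor>) = of_int \<lfloor>a\<rfloor>" by simp
  show "real (nat \<lfloor>a\<rfloor>) \<le> a" "a < real (nat \<lfloor>a\<rfloor>) + 1" unfolding r by linarith+
  have "real (nat \<lfloor>a\<rfloor>) \<ge> 1" using f unfolding r by simp
  then show "a / 2 \<le> real (nat \<lfloor>a\<rfloor>)" using \<open>a < real (nat \<lfloor>a\<rfloor>) + 1\<close> by linarith
  show "nat \<lfloor>a\<rfloor> \<ge> 1" using f by linarith
qed

text \<open>The cutoffs depend on \<open>N\<close> alone, apart from the constants \<open>T\<close> and \<open>\<kappa>\<close>.  Up to rounding, they
  are as follows.
  \<^item> \<open>w\<close> is $\ln N$, so that square divisors above $w^2$ are rare, while the reciprocals of the primes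
    up to $w^6$ have a sum of size $O(\ln\ln\ln N)$.
  \<^item> \<open>K\<close> is $8 \ln N$, so that $2^K \ge N^4 \ge s(m)\sigma(m)$, because $\ln 2 \ge 1/2$.
  \<^item> \<open>z\<close> is $N^{1/T}$; the proportion of \<open>z\<close>-smooth numbers is $O(1/T)$.
  \<^item> \<open>R\<close> is $N^{1/(16T)}$, so that the error $R^4$ is at most $z^{1/4}$.
  \<^item> \<open>y\<close> is $N^{1/(\kappa \ln\ln N)}$, so that at most $2 \kappa \ln\ln N$ primes above \<open>y\<close> divide $s(n)$,
    while $y^2$ is at most $z^{1/4}$ for large \<open>N\<close>.\<close>
locale cutoffs =
  fixes \<kappa> T :: real and N :: nat
  fixes l L :: real and w K z R y :: nat
  defines "l \<equiv> ln (real N)" and "L \<equiv> ln (ln (real N))"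
  defines "w \<equiv> nat \<lfloor>ln (real N)\<rfloor>" and "K \<equiv> nat \<lceil>8 * ln (real N)\<rceil>"
  defines "z \<equiv> nat \<lfloor>exp (ln (real N) / T)\<rfloor>" and "R \<equiv> nat \<lfloor>exp (ln (real N) / (16 * T))\<rfloor>"
  defines "y \<equiv> nat \<lfloor>exp (ln (real N) / (\<kappa> * ln (ln (real N))))\<rfloor>"
  assumes \<kappa>: "\<kappa> > 0" and T: "T \<ge> 1"
    and N3: "N \<ge> 3"
    and large: "ln (real N) \<ge> 4" "ln (ln (real N)) \<ge> 1" "8 * ln (ln (real N)) \<le> ln (real N)"
      "ln (real N) \<le> exp (ln (real N) / T) / 2"
      "8 * T \<le> \<kappa> * ln (ln (real N))" "3 \<le> ln (real N) / (\<kappa> * ln (ln (real N)))"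
begin

lemma l4: "l \<ge> 4" and L1: "L \<ge> 1" and lL: "8 * L \<le> l" and lz: "l \<le> exp (l / T) / 2"
  and \<kappa>L: "8 * T \<le> \<kappa> * L" "\<kappa> * L \<ge> 1" "\<kappa> * L > 0" and a3: "3 \<le> l / (\<kappa> * L)" and L_def': "L = ln l"
  using large T unfolding l_def L_def by auto

lemma N_exp: "real N = exp l"
  using N3 by (simp add: l_def)

lemma w: "real w \<le> l" "l / 2 \<le> real w" "w \<ge> 2"
proof -
  show "real w \<le> l" "l / 2 \<le> real w"
    using nat_floor_bounds[of l] l4 unfolding w_def l_def by auto
  then show "w \<ge> 2" using l4 by linarith
qed

lemma z: "real z \<le> exp (l / T)" "exp (l / T) < real z + 1" "exp (l / T) / 2 \<le> real z" "z \<ge> 1"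
  using nat_floor_bounds[of "exp (l / T)"] l4 T unfolding z_def l_def by auto

lemma R: "real R \<le> exp (l / (16 * T))" "exp (l / (16 * T)) < real R + 1" "R \<ge> 1"
  using nat_floor_bounds[of "exp (l / (16 * T))"] l4 T unfolding R_def l_def by auto

lemma y: "real y \<le> exp (l / (\<kappa> * L))" "exp (l / (\<kappa> * L)) < real y + 1" "exp (l / (\<kappa> * L)) / 2 \<le> real y"
  using nat_floor_bounds[of "exp (l / (\<kappa> * L))"] a3 unfolding y_def l_def L_def by auto

lemma R_le_z: "R \<le> z"
proof -
  have "l / (16 * T) \<le> l / T" using l4 T by (intro divide_left_mono) auto
  then show ?thesis unfolding R_def z_def l_def[symmetric] by (intro nat_mono floor_mono) simp
qed

lemma w_le_z: "w \<le> z"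
  using w lz z by linarith

lemma y3: "3 \<le> y" and y_le_N: "y \<le> N"
proof -
  have "exp (l / (\<kappa> * L)) \<ge> exp 3" using a3 by simp
  moreover have "exp (3::real) \<ge> 1 + 3" by (rule exp_ge_add_one_self)
  ultimately have "real y > 3" using y by linarith
  then show "3 \<le> y" by simp
  have "l / (\<kappa> * L) \<le> l / 1" using l4 \<kappa>L by (intro divide_left_mono) auto
  then have "exp (l / (\<kappa> * L)) \<le> exp l" by simp
  then have "real y \<le> real N" using y(1) unfolding N_exp by linarith
  then show "y \<le> N" by simp
qed

lemma K: "8 * l \<le> real K" "real K \<le> 8 * l + 1" "K \<ge> 3" "N ^ 4 \<le> 2 ^ K" "N \<le> 2 ^ K"
proof -
  have "\<lceil>8 * l\<rceil> \<ge> 0" using l4 by linarith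
  then have r: "real K = of_int \<lceil>8 * l\<rceil>" unfolding K_def l_def by simp
  show 1: "8 * l \<le> real K" "real K \<le> 8 * l + 1" unfolding r by linarith+
  show "K \<ge> 3" using 1 l4 by linarith
  have "ln (1 / 2 :: real) \<le> 1 / 2 - 1" by (rule ln_le_minus_one) simp
  then have "ln (2::real) \<ge> 1 / 2" by (simp add: ln_div)
  then have "real K * (1 / 2) \<le> real K * ln 2" by (intro mult_left_mono) auto
  then have "4 * l \<le> real K * ln 2" using 1 by linarith
  then have "exp (4 * l) \<le> exp (real K * ln 2)" by simp
  also have "exp (real K * ln 2) = 2 ^ K" by (simp add: exp_of_nat_mult)
  also have "exp (4 * l) = real N ^ 4" unfolding N_exp using exp_of_nat_mult[of 4 l] by simp
  finally have "real (N ^ 4) \<le> real (2 ^ K)" by simp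
  then show "N ^ 4 \<le> 2 ^ K" by (simp only: of_nat_le_iff)
  moreover have "N ^ 1 \<le> N ^ 4" using N3 by (intro power_increasing) auto
  ultimately show "N \<le> 2 ^ K" by simp
qed

lemma lnln_K: "ln (ln (real K)) \<le> ln (ln (8 * l + 1))" "0 \<le> ln (ln (real K))"
proof -
  have K16: "real K \<ge> 3" using K by linarith
  have "exp 1 \<le> real K" using exp_le K16 by linarith
  then have 1: "ln (real K) \<ge> 1" using K16 by (subst ln_ge_iff) auto
  then show "0 \<le> ln (ln (real K))" by simp
  have "ln (real K) \<le> ln (8 * l + 1)" using K K16 by (intro ln_mono) auto
  then show "ln (ln (real K)) \<le> ln (ln (8 * l + 1))" using 1 by - (rule ln_mono; linarith)
qed

definition irregular :: "nat \<Rightarrow> bool" where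
  "irregular n \<longleftrightarrow>
     (\<exists>k>w. k ^ 2 dvd n) \<or> n ^ 2 < N \<or>
     (N \<le> n ^ 2 \<and> (\<forall>k. k ^ 2 dvd n \<longrightarrow> k \<le> w) \<and> (\<forall>p. prime p \<longrightarrow> p dvd n \<longrightarrow> p \<le> z)) \<or>
     \<kappa> * L \<le> real (card {p. p \<in> primes_upto (w ^ 6) \<and> p dvd n}) \<or>
     (\<exists>p q. prime p \<and> prime q \<and> p > w ^ 6 \<and> p dvd q + 1 \<and> p * q dvd n) \<or>
     prime n \<or> exceptional_on_fibre z y (\<kappa> * L) n"

lemma omega_aliquot_sum_bounds:
  assumes n: "n \<in> {1..N}" and reg: "\<not> irregular n"
  shows "aliquot_sum n > 1"
    and "L - ln T \<le> ln (ln (real (aliquot_sum n)))" "ln (ln (real (aliquot_sum n))) \<le> ln (2 * l)"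
    and "ln (l / (2 * (\<kappa> * L))) - 11 - ln (ln (8 * l + 1)) - \<kappa> * L \<le> real (omega (aliquot_sum n))"
    and "real (omega (aliquot_sum n)) \<le> L + 10 + 4 * (\<kappa> * L)"
proof -
  let ?S = "aliquot_sum n"
  have N2: "N \<le> n ^ 2" and np: "\<not> prime n"
    and few: "real (card {p. p \<in> primes_upto (w ^ 6) \<and> p dvd n}) < \<kappa> * L"
    and ex: "\<not> exceptional_on_fibre z y (\<kappa> * L) n"
    using reg unfolding irregular_def de_Morgan_disj not_less not_le by simp_all
  have sq: "k \<le> w" if "k ^ 2 dvd n" for k
    using reg that unfolding irregular_def by (meson not_le)
  have link: "\<not> p * q dvd n" if "prime p" "prime q" "p > w ^ 6" "p dvd q + 1" for p q
    using reg that unfolding irregular_def by blast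
  have rough: "\<not> (\<forall>p. prime p \<longrightarrow> p dvd n \<longrightarrow> p \<le> z)"
    using reg N2 sq unfolding irregular_def by blast
  note facts = omega_aliquot_sum_regular[OF n N2 np sq rough few link ex w_le_z y3 y_le_N K(4) K(3)]
  have zS: "z < ?S" using facts(1) by simp
  then show "?S > 1" using z(4) by simp
  have "real z + 1 \<le> real ?S" using zS by linarith
  then have "exp (l / T) \<le> real ?S" using z by linarith
  moreover have lT: "l / T > 0" using l4 T by simp
  ultimately have lnS: "l / T \<le> ln (real ?S)" using zS by (subst ln_ge_iff) auto
  have "L - ln T = ln (l / T)" unfolding L_def' using l4 T by (simp add: ln_div)
  also have "\<dots> \<le> ln (ln (real ?S))" using lnS lT by (intro ln_mono) auto
  finally show "L - ln T \<le> ln (ln (real ?S))" .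
  have "ln (real ?S) \<le> ln (real N ^ 2)" using facts(2) zS by (intro ln_mono) auto
  also have "\<dots> = 2 * l" using N3 by (simp add: ln_realpow l_def)
  finally show "ln (ln (real ?S)) \<le> ln (2 * l)" using lnS lT by (intro ln_mono) auto
  have "l / (2 * (\<kappa> * L)) \<le> ln (real y)"
  proof -
    have "l / (\<kappa> * L) - ln 2 = ln (exp (l / (\<kappa> * L)) / 2)" by (simp add: ln_div)
    also have "\<dots> \<le> ln (real y)" using y(3) y3 by (intro ln_mono) auto
    finally have "l / (\<kappa> * L) - ln 2 \<le> ln (real y)" .
    moreover have "a / 2 \<le> b" if "a - ln 2 \<le> b" "3 \<le> a" for a b :: real
      using that ln_2_less_1 by linarith
    ultimately have "l / (\<kappa> * L) / 2 \<le> ln (real y)" using a3 by blast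
    also have "l / (\<kappa> * L) / 2 = l / (2 * (\<kappa> * L))" by simp
    finally show ?thesis .
  qed
  then have "ln (l / (2 * (\<kappa> * L))) \<le> ln (ln (real y))"
    using l4 \<kappa>L by (intro ln_mono) (auto intro!: divide_pos_pos)
  then show "ln (l / (2 * (\<kappa> * L))) - 11 - ln (ln (8 * l + 1)) - \<kappa> * L \<le> real (omega ?S)"
    using facts(3) lnln_K by linarith
  have "l / (\<kappa> * L) \<le> ln (real y + 1)" using y(2) by (subst ln_ge_iff) auto
  then have "2 * l / ln (real y + 1) \<le> 2 * l / (l / (\<kappa> * L))"
    using l4 \<kappa>L a3 y3 by (intro divide_left_mono mult_pos_pos) auto
  also have "\<dots> = 2 * (\<kappa> * L)" using l4 by simp
  finally show "real (omega ?S) \<le> L + 10 + 4 * (\<kappa> * L)"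
    using facts(4) unfolding l_def L_def by linarith
qed

lemma card_large_square: "real (card {n\<in>{1..N}. \<exists>k>w. k ^ 2 dvd n}) \<le> real N * (2 / l)"
proof -
  have "real (card {n\<in>{1..N}. \<exists>k>w. k ^ 2 dvd n}) \<le> real N / real w"
    using w by (intro card_large_square_divisor_le) auto
  also have "\<dots> \<le> real N / (l / 2)"
    using w l4 by (intro divide_left_mono mult_pos_pos) auto
  finally show ?thesis by (simp add: field_simps)
qed

lemma card_smooth:
  "real (card {n\<in>{1..N}. N \<le> n ^ 2 \<and> (\<forall>k. k ^ 2 dvd n \<longrightarrow> k \<le> w) \<and> (\<forall>p. prime p \<longrightarrow> p dvd n \<longrightarrow> p \<le> z)})
     \<le> real N * (8 / T)" (is "real (card ?A) \<le> _")
proof -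
  have "ln (real w) \<le> L" unfolding L_def' using w by (intro ln_mono) auto
  then have "l / 4 \<le> l / 2 - 2 * ln (real w)" using lL by linarith
  then have "real (card ?A) * (l / 4) \<le> real (card ?A) * (l / 2 - 2 * ln (real w))"
    by (intro mult_left_mono) auto
  also have "\<dots> \<le> 2 * real N * ln (real z)"
    unfolding l_def using w z by (intro card_smooth_le) auto
  also have "\<dots> \<le> 2 * real N * (l / T)"
  proof (intro mult_left_mono)
    have "ln (real z) \<le> ln (exp (l / T))" using z by (intro ln_mono) auto
    then show "ln (real z) \<le> l / T" by simp
  qed auto
  also have "\<dots> = real N * (8 / T) * (l / 4)" by simp
  finally have "real (card ?A) * (l / 4) \<le> real N * (8 / T) * (l / 4)" .
  then show ?thesis using l4 by (subst (asm) mult_le_cancel_right) auto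
qed

lemma card_many_small_primes:
  "real (card {n\<in>{1..N}. \<kappa> * L \<le> real (card {p. p \<in> primes_upto (w ^ 6) \<and> p dvd n})})
     \<le> real N * ((ln (6 * L) + 5) / (\<kappa> * L))" (is "real (card ?A) \<le> _")
proof -
  have "(2::nat) ^ 6 \<le> w ^ 6" using w by (intro power_mono) auto
  then have w6: "w ^ 6 \<ge> 3" by simp
  have "real (card ?A) * (\<kappa> * L) \<le> real N * (ln (ln (real (w ^ 6))) + 5)"
    by (rule card_many_small_primes_le[OF w6])
  also have "ln (real (w ^ 6)) = 6 * ln (real w)" using w by (simp add: ln_realpow)
  also have "real N * (ln (6 * ln (real w)) + 5) \<le> real N * (ln (6 * L) + 5)"
  proof -
    have "ln (real w) \<le> L" unfolding L_def' using w by (intro ln_mono) auto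
    moreover have "ln (real w) > 0" using w by simp
    ultimately show ?thesis by (intro mult_left_mono add_right_mono ln_mono) auto
  qed
  finally show ?thesis using \<kappa>L by (simp add: pos_le_divide_eq)
qed

lemma card_linked:
  "real (card {n\<in>{1..N}. \<exists>p q. prime p \<and> prime q \<and> p > w ^ 6 \<and> p dvd q + 1 \<and> p * q dvd n})
     \<le> real N * (2 * (1 + l) / (l / 2) ^ 6)" (is "real (card ?A) \<le> _")
proof -
  have "real (card ?A) \<le> 2 * real N * (1 + l) / real (w ^ 6)"
    unfolding l_def using w N3 by (intro card_linked_primes_le) auto
  also have "\<dots> \<le> 2 * real N * (1 + l) / (l / 2) ^ 6"
  proof -
    have "(l / 2) ^ 6 \<le> real w ^ 6" using w l4 by (intro power_mono) auto
    moreover have "(l / 2) ^ 6 > 0" using l4 by simp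
    ultimately show ?thesis using l4 w by (intro divide_left_mono mult_pos_pos) auto
  qed
  also have "\<dots> = real N * (2 * (1 + l) / (l / 2) ^ 6)" by (simp add: algebra_simps)
  finally show ?thesis .
qed

lemma R_pow4: "real R ^ 4 \<le> exp (l / (4 * T))"
proof -
  have "real R ^ 4 \<le> exp (l / (16 * T)) ^ 4" using R by (intro power_mono) auto
  also have "\<dots> = exp (l / (4 * T))" by (simp flip: exp_of_nat_mult)
  finally show ?thesis .
qed

lemma ln_R: "l / (16 * T) \<le> ln (real R + 1)"
  using R(2) by (subst ln_ge_iff) auto

lemma card_primes: "real (card {n\<in>{1..N}. prime n}) \<le> real N * (32 * T / l + 2 * exp (- (3 / 4) * l))"
proof -
  have "real (card {n\<in>{1..N}. prime n}) \<le> 2 * real N / ln (real R + 1) + real R ^ 4 + real R"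
    by (rule card_primes_upto_le[OF R(3)])
  also have "2 * real N / ln (real R + 1) \<le> 2 * real N / (l / (16 * T))"
    using ln_R R(3) l4 T by (intro divide_left_mono mult_pos_pos) auto
  also have "2 * real N / (l / (16 * T)) + real R ^ 4 + real R \<le> 2 * real N / (l / (16 * T)) + 2 * exp (l / (4 * T))"
  proof -
    have "real R \<le> real R ^ 4" using R(3) by (intro self_le_power) auto
    then show ?thesis using R_pow4 by linarith
  qed
  also have "exp (l / (4 * T)) \<le> exp (l / 4)"
  proof -
    have "l / (4 * T) \<le> l / 4" using l4 T by (intro divide_left_mono) auto
    then show ?thesis by simp
  qed
  also have "exp (l / 4) = real N * exp (- (3 / 4) * l)"
    unfolding N_exp by (simp flip: exp_add)
  finally show ?thesis by (simp add: algebra_simps)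
qed

lemma card_exceptional:
  "real (card {n\<in>{1..N}. exceptional_on_fibre z y (\<kappa> * L) n})
     \<le> real N * (((64 * T + 2) * ((L + 9) * (1 + 2 * (ln (ln (8 * l + 1)) + 10))) + 12) / (\<kappa> * L) ^ 2)"
    (is "real (card ?A) \<le> _")
proof -
  define G M where "G = ln (ln (real K)) + 10" and "M = ln (ln (real N)) + 9"
  have G0: "G \<ge> 0" using lnln_K by (simp add: G_def)
  have M9: "M = L + 9" by (simp add: M_def L_def)
  have N0: "real N > 0" using N3 by simp
  have zN: "real N / real z \<le> 2 * real N * exp (- (l / T))"
  proof -
    have "real N / real z \<le> real N / (exp (l / T) / 2)"
      using z by (intro divide_left_mono mult_pos_pos) auto
    then show ?thesis by (simp add: exp_minus field_simps)
  qed
  have yy: "real y ^ 2 \<le> exp (l / (4 * T))"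
  proof -
    have "real y ^ 2 \<le> exp (l / (\<kappa> * L)) ^ 2" using y by (intro power_mono) auto
    also have "\<dots> = exp (2 * (l / (\<kappa> * L)))" by (simp flip: exp_of_nat_mult)
    also have "2 * (l / (\<kappa> * L)) \<le> 2 * (l / (8 * T))"
      using \<kappa>L T l4 \<kappa> L1 by (intro mult_left_mono divide_left_mono mult_pos_pos) auto
    finally show ?thesis by simp
  qed
  have b1: "real N / real z * real R ^ 4 \<le> 2 * real N"
  proof -
    have "real N / real z * real R ^ 4 \<le> (2 * real N * exp (- (l / T))) * exp (l / (4 * T))"
      by (intro mult_mono zN R_pow4) auto
    also have "\<dots> = 2 * real N * (exp (- (l / T)) * exp (l / (4 * T)))" by simp
    also have "exp (- (l / T)) * exp (l / (4 * T)) = exp (l / (4 * T) - l / T)" by (simp flip: exp_add)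
    also have "2 * real N * exp (l / (4 * T) - l / T) \<le> 2 * real N * 1"
      using l4 T by (intro mult_left_mono) (auto intro!: divide_left_mono)
    finally show ?thesis by simp
  qed
  have b2: "real N / real z * (6 * real R ^ 4 * real y ^ 2) \<le> 12 * real N"
  proof -
    have "real N / real z * (6 * real R ^ 4 * real y ^ 2)
        \<le> (2 * real N * exp (- (l / T))) * (6 * exp (l / (4 * T)) * exp (l / (4 * T)))"
      by (intro mult_mono zN R_pow4 yy) auto
    also have "\<dots> = 12 * real N * (exp (- (l / T)) * exp (l / (4 * T)) * exp (l / (4 * T)))" by simp
    also have "exp (- (l / T)) * exp (l / (4 * T)) * exp (l / (4 * T)) = exp (l / (4 * T) + l / (4 * T) - l / T)"
      by (simp flip: exp_add)
    also have "l / (4 * T) + l / (4 * T) - l / T = - (l / (2 * T))" using T by (simp add: field_simps)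
    also have "12 * real N * exp (- (l / (2 * T))) \<le> 12 * real N * 1"
      using l4 T by (intro mult_left_mono) auto
    finally show ?thesis by simp
  qed
  have b3: "2 * real N * (1 + l) / ln (real R + 1) \<le> 64 * T * real N"
  proof -
    have "2 * real N * (1 + l) / ln (real R + 1) \<le> 2 * real N * (2 * l) / (l / (16 * T))"
      using ln_R R(3) l4 T N0 by (intro frac_le mult_left_mono) auto
    also have "\<dots> = 64 * T * real N" using l4 by simp
    finally show ?thesis .
  qed
  have "real (card ?A) * (\<kappa> * L) ^ 2
      \<le> (2 * real N * (1 + l) / ln (real R + 1) + real N / real z * real R ^ 4) * (M * (1 + 2 * G))
         + real N / real z * (6 * real R ^ 4 * real y ^ 2)"
    unfolding l_def
    by (rule card_exceptional_on_fibres_le[OF K(5) K(3) y3 y_le_N R(3) R_le_z _ G_def G0 M_def])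
       (use \<kappa>L in auto)
  also have "\<dots> \<le> (64 * T * real N + 2 * real N) * ((L + 9) * (1 + 2 * (ln (ln (8 * l + 1)) + 10))) + 12 * real N"
  proof (rule add_mono[OF mult_mono[OF add_mono[OF b3 b1]] b2])
    show "M * (1 + 2 * G) \<le> (L + 9) * (1 + 2 * (ln (ln (8 * l + 1)) + 10))"
      unfolding M9 G_def using L1 lnln_K by (intro mult_left_mono) auto
    show "0 \<le> 64 * T * real N + 2 * real N" using T by simp
    show "0 \<le> M * (1 + 2 * G)" using M9 L1 G0 by simp
  qed
  also have "\<dots> = real N * ((64 * T + 2) * ((L + 9) * (1 + 2 * (ln (ln (8 * l + 1)) + 10))) + 12)"
    by (simp add: algebra_simps)
  finally have "real (card ?A) \<le> real N * ((64 * T + 2) * ((L + 9) * (1 + 2 * (ln (ln (8 * l + 1)) + 10))) + 12) / (\<kappa> * L) ^ 2"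
    using zero_less_power[OF \<kappa>L(3), of 2] by (simp only: pos_le_divide_eq)
  then show ?thesis by simp
qed

text \<open>After division by \<open>N\<close>, every term tends to \<open>0\<close> except $8/T$, the contribution of the smooth
  numbers.\<close>
lemma card_irregular:
  "real (card {n\<in>{1..N}. irregular n}) \<le> real N *
     (2 / l + exp (- l / 2) + 8 / T + (ln (6 * L) + 5) / (\<kappa> * L) + 2 * (1 + l) / (l / 2) ^ 6
       + (32 * T / l + 2 * exp (- (3 / 4) * l))
       + ((64 * T + 2) * ((L + 9) * (1 + 2 * (ln (ln (8 * l + 1)) + 10))) + 12) / (\<kappa> * L) ^ 2)"
proof -
  have sqrtN: "real (card {n\<in>{1..N}. n ^ 2 < N}) \<le> real N * exp (- l / 2)"
  proof -
    have "sqrt (real N) = exp (l / 2)"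
      unfolding N_exp by (rule real_sqrt_unique) (auto simp flip: exp_of_nat_mult)
    also have "\<dots> = real N * exp (- l / 2)" unfolding N_exp by (simp flip: exp_add)
    finally show ?thesis using card_small_squares_le[of N] by simp
  qed
  let ?A1 = "{n\<in>{1..N}. \<exists>k>w. k ^ 2 dvd n}" and ?A2 = "{n\<in>{1..N}. n ^ 2 < N}"
  let ?A3 = "{n\<in>{1..N}. N \<le> n ^ 2 \<and> (\<forall>k. k ^ 2 dvd n \<longrightarrow> k \<le> w) \<and> (\<forall>p. prime p \<longrightarrow> p dvd n \<longrightarrow> p \<le> z)}"
  let ?A4 = "{n\<in>{1..N}. \<kappa> * L \<le> real (card {p. p \<in> primes_upto (w ^ 6) \<and> p dvd n})}"
  let ?A5 = "{n\<in>{1..N}. \<exists>p q. prime p \<and> prime q \<and> p > w ^ 6 \<and> p dvd q + 1 \<and> p * q dvd n}"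
  let ?A6 = "{n\<in>{1..N}. prime n}" and ?A7 = "{n\<in>{1..N}. exceptional_on_fibre z y (\<kappa> * L) n}"
  have "{n\<in>{1..N}. irregular n} \<subseteq> ?A1 \<union> ?A2 \<union> ?A3 \<union> ?A4 \<union> ?A5 \<union> ?A6 \<union> ?A7"
    by (auto simp: irregular_def)
  then have "card {n\<in>{1..N}. irregular n} \<le> card (?A1 \<union> ?A2 \<union> ?A3 \<union> ?A4 \<union> ?A5 \<union> ?A6 \<union> ?A7)"
    by (intro card_mono) auto
  also have "\<dots> \<le> card ?A1 + card ?A2 + card ?A3 + card ?A4 + card ?A5 + card ?A6 + card ?A7"
    by (intro order_trans[OF card_Un_le] add_mono order_refl)
  finally have "real (card {n\<in>{1..N}. irregular n}) \<le> real (card ?A1 + card ?A2 + card ?A3 + card ?A4 + card ?A5 + card ?A6 + card ?A7)"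
    by (rule of_nat_mono)
  also have "\<dots> = real (card ?A1) + real (card ?A2) + real (card ?A3) + real (card ?A4) + real (card ?A5) + real (card ?A6) + real (card ?A7)"
    by (simp only: of_nat_add)
  also have "\<dots> \<le> real N * (2 / l) + real N * exp (- l / 2) + real N * (8 / T) + real N * ((ln (6 * L) + 5) / (\<kappa> * L))
     + real N * (2 * (1 + l) / (l / 2) ^ 6) + real N * (32 * T / l + 2 * exp (- (3 / 4) * l))
     + real N * (((64 * T + 2) * ((L + 9) * (1 + 2 * (ln (ln (8 * l + 1)) + 10))) + 12) / (\<kappa> * L) ^ 2)"
    by (intro add_mono card_large_square sqrtN card_smooth card_many_small_primes card_linked card_primes card_exceptional)
  finally show ?thesis by (simp only: distrib_left)
qed

end

lemma eventually_cutoffs: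
  assumes \<kappa>: "\<kappa> > 0" and T: "T \<ge> 1"
  shows "eventually (\<lambda>N. cutoffs \<kappa> T N) at_top"
  unfolding cutoffs_def using \<kappa> T
  by (intro eventually_conj; (real_asymp | rule eventually_ge_at_top | simp))

lemma eventually_card_irregular:
  assumes \<kappa>: "\<kappa> > 0" and T: "T \<ge> 1" and \<eta>: "\<eta> > 8 / T"
  shows "eventually (\<lambda>N. real (card {n\<in>{1..N}. cutoffs.irregular \<kappa> T N n}) \<le> \<eta> * real N) at_top"
proof -
  define h :: "real \<Rightarrow> real" where "h x = (let l = ln x; L = ln (ln x) in
      2 / l + exp (- l / 2) + 8 / T + (ln (6 * L) + 5) / (\<kappa> * L) + 2 * (1 + l) / (l / 2) ^ 6
       + (32 * T / l + 2 * exp (- (3 / 4) * l))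
       + ((64 * T + 2) * ((L + 9) * (1 + 2 * (ln (ln (8 * l + 1)) + 10))) + 12) / (\<kappa> * L) ^ 2)" for x
  have "(h \<longlongrightarrow> 8 / T) at_top"
    unfolding h_def Let_def using \<kappa> T by real_asymp
  then have "eventually (\<lambda>x. h x < \<eta>) at_top" using \<eta> by (rule order_tendstoD)
  then have "eventually (\<lambda>N. h (real N) < \<eta>) at_top"
    by (rule eventually_compose_filterlim[OF _ filterlim_real_sequentially])
  with eventually_cutoffs[OF \<kappa> T] show ?thesis
  proof eventually_elim
    case (elim N)
    interpret cutoffs \<kappa> T N "ln (real N)" "ln (ln (real N))" "nat \<lfloor>ln (real N)\<rfloor>" "nat \<lceil>8 * ln (real N)\<rceil>"
      "nat \<lfloor>exp (ln (real N) / T)\<rfloor>" "nat \<lfloor>exp (ln (real N) / (16 * T))\<rfloor>"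
      "nat \<lfloor>exp (ln (real N) / (\<kappa> * ln (ln (real N))))\<rfloor>"
      using elim(1) by simp_all
    have "real (card {n\<in>{1..N}. irregular n}) \<le> real N * h (real N)"
      using card_irregular unfolding h_def Let_def .
    also have "\<dots> \<le> real N * \<eta>" using elim(2) by (intro mult_left_mono) auto
    finally show ?case by (simp add: mult.commute)
  qed
qed

text \<open>With threshold $\kappa \ln\ln N$ for each source of error, $\omega(s(n))$ deviates from $\ln\ln N$ by at
  most $(4\kappa + o(1)) \ln\ln N$, and $\ln\ln s(n)$ differs from $\ln\ln N$ by $O(1)$.\<close>
lemma eventually_regular:
  assumes \<kappa>: "\<kappa> > 0" and T: "T \<ge> 1" and \<epsilon>: "\<epsilon> \<ge> 8 * \<kappa>"
  shows "eventually (\<lambda>N. \<forall>n\<in>{1..N}. \<not> cutoffs.irregular \<kappa> T N n \<longrightarrow>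
           aliquot_sum n > 1 \<and>
           \<bar>real (omega (aliquot_sum n)) - ln (ln (real (aliquot_sum n)))\<bar>
             < \<epsilon> * ln (ln (real (aliquot_sum n)))) at_top"
proof -
  have "eventually (\<lambda>x::real. ln (ln x) + 10 + 4 * (\<kappa> * ln (ln x)) < (1 + 8 * \<kappa>) * (ln (ln x) - ln T)) at_top"
    using \<kappa> T by real_asymp
  then have up: "eventually (\<lambda>N. ln (ln (real N)) + 10 + 4 * (\<kappa> * ln (ln (real N))) < (1 + 8 * \<kappa>) * (ln (ln (real N)) - ln T)) at_top"
    by (rule eventually_compose_filterlim[OF _ filterlim_real_sequentially])
  have "eventually (\<lambda>x::real. ln (2 * ln x) - (ln (ln x / (2 * (\<kappa> * ln (ln x)))) - 11 - ln (ln (8 * ln x + 1)) - \<kappa> * ln (ln x))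
      < 8 * \<kappa> * (ln (ln x) - ln T)) at_top"
    using \<kappa> T by real_asymp
  then have low: "eventually (\<lambda>N. ln (2 * ln (real N)) - (ln (ln (real N) / (2 * (\<kappa> * ln (ln (real N))))) - 11 - ln (ln (8 * ln (real N) + 1)) - \<kappa> * ln (ln (real N)))
      < 8 * \<kappa> * (ln (ln (real N)) - ln T)) at_top"
    by (rule eventually_compose_filterlim[OF _ filterlim_real_sequentially])
  have "eventually (\<lambda>x::real. ln (ln x) - ln T > 0) at_top" using T by real_asymp
  then have pos: "eventually (\<lambda>N. ln (ln (real N)) - ln T > 0) at_top"
    by (rule eventually_compose_filterlim[OF _ filterlim_real_sequentially])
  from eventually_cutoffs[OF \<kappa> T] up low pos show ?thesis
  proof eventually_elim
    case (elim N)
    interpret cutoffs \<kappa> T N "ln (real N)" "ln (ln (real N))" "nat \<lfloor>ln (real N)\<rfloor>" "nat \<lceil>8 * ln (real N)\<rceil>"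
      "nat \<lfloor>exp (ln (real N) / T)\<rfloor>" "nat \<lfloor>exp (ln (real N) / (16 * T))\<rfloor>"
      "nat \<lfloor>exp (ln (real N) / (\<kappa> * ln (ln (real N))))\<rfloor>"
      using elim(1) by simp_all
    show ?case
    proof (intro ballI impI)
      fix n assume n: "n \<in> {1..N}" "\<not> irregular n"
      let ?S = "aliquot_sum n"
      let ?l = "ln (ln (real ?S))"
      note b = omega_aliquot_sum_bounds[OF n]
      have "(1 + 8 * \<kappa>) * (ln (ln (real N)) - ln T) \<le> (1 + 8 * \<kappa>) * ?l"
        using b(2) \<kappa> by (intro mult_left_mono) auto
      then have "real (omega ?S) < (1 + 8 * \<kappa>) * ?l" using b(5) elim(2) by linarith
      then have 1: "real (omega ?S) - ?l < 8 * \<kappa> * ?l" by (simp add: algebra_simps)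
      have "8 * \<kappa> * (ln (ln (real N)) - ln T) \<le> 8 * \<kappa> * ?l"
        using b(2) \<kappa> by (intro mult_left_mono) auto
      then have 2: "?l - real (omega ?S) < 8 * \<kappa> * ?l" using b(3,4) elim(3) by linarith
      have "8 * \<kappa> * ?l \<le> \<epsilon> * ?l" using \<epsilon> b(2) elim(4) by (intro mult_right_mono) auto
      with 1 2 have "\<bar>real (omega ?S) - ?l\<bar> < \<epsilon> * ?l" by linarith
      with b(1) show "?S > 1 \<and> \<bar>real (omega ?S) - ?l\<bar> < \<epsilon> * ?l" by simp
    qed
  qed
qed

theorem theorem1p3:
  fixes \<epsilon> :: real
  assumes "\<epsilon> > 0"
  shows "(\<lambda>x::real. real (card {n::nat. 0 < n \<and> real n \<le> x \<and>
            \<not> (aliquot_sum n > 1 \<and>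
               \<bar>real (omega (aliquot_sum n)) - ln (ln (real (aliquot_sum n)))\<bar>
                 < \<epsilon> * ln (ln (real (aliquot_sum n))))}))
         \<in> o[at_top](\<lambda>x. x)"
proof (rule landau_o.smallI)
  fix \<eta> :: real assume \<eta>: "\<eta> > 0"
  \<comment> \<open>the smooth numbers have proportion $8/T \le \eta/2$, which leaves room for the vanishing terms\<close>
  define T where "T = max 1 (16 / \<eta>)"
  define \<kappa> where "\<kappa> = \<epsilon> / 8"
  let ?good = "\<lambda>n. aliquot_sum n > 1 \<and>
     \<bar>real (omega (aliquot_sum n)) - ln (ln (real (aliquot_sum n)))\<bar> < \<epsilon> * ln (ln (real (aliquot_sum n)))"
  have \<kappa>: "\<kappa> > 0" "\<epsilon> \<ge> 8 * \<kappa>" using assms by (auto simp: \<kappa>_def)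
  have T: "T \<ge> 1" by (simp add: T_def)
  have "8 / T \<le> 8 / (16 / \<eta>)" using \<eta> by (intro divide_left_mono) (auto simp: T_def max_def)
  also have "\<dots> < \<eta>" using \<eta> by simp
  finally have \<eta>T: "\<eta> > 8 / T" .
  have nat_floor: "filterlim (\<lambda>x::real. nat \<lfloor>x\<rfloor>) at_top at_top"
    by (rule filterlim_compose[OF filterlim_nat_sequentially filterlim_floor_sequentially])
  have "eventually (\<lambda>N. real (card {n\<in>{1..N}. \<not> ?good n}) \<le> \<eta> * real N) at_top"
    using eventually_card_irregular[OF \<kappa>(1) T \<eta>T] eventually_regular[OF \<kappa>(1) T \<kappa>(2)]
  proof eventually_elim
    case (elim N)
    have "card {n\<in>{1..N}. \<not> ?good n} \<le> card {n\<in>{1..N}. cutoffs.irregular \<kappa> T N n}"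
      using elim(2) by (intro card_mono) auto
    then show ?case using elim(1) by linarith
  qed
  then have "eventually (\<lambda>x. real (card {n\<in>{1..nat \<lfloor>x\<rfloor>}. \<not> ?good n}) \<le> \<eta> * real (nat \<lfloor>x\<rfloor>)) (at_top :: real filter)"
    by (rule eventually_compose_filterlim[OF _ nat_floor])
  with eventually_ge_at_top[of "0::real"]
  show "eventually (\<lambda>x. norm (real (card {n. 0 < n \<and> real n \<le> x \<and> \<not> ?good n})) \<le> \<eta> * norm x) at_top"
  proof eventually_elim
    case (elim x)
    have "{n. 0 < n \<and> real n \<le> x \<and> \<not> ?good n} = {n\<in>{1..nat \<lfloor>x\<rfloor>}. \<not> ?good n}"
      using elim(1) by (auto simp: le_nat_floor Suc_le_eq dest: le_nat_floor intro: order_trans[OF _ of_nat_floor])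
    then have "real (card {n. 0 < n \<and> real n \<le> x \<and> \<not> ?good n}) \<le> \<eta> * real (nat \<lfloor>x\<rfloor>)"
      using elim(2) by simp
    also have "\<dots> \<le> \<eta> * x" using elim(1) \<eta> by (intro mult_left_mono of_nat_floor) auto
    finally show ?case using elim(1) by simp
  qed
qed

end
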